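(* Let $(\overline N,g_{\overline N})$ be a tree-level q-map space associated with a projective special real manifold $(\mathcal H,g_{\mathcal H})$ of dimension $n-1\ge 0$. Then the S-duality action of $\mathrm{SL}(2,\mathbb R)$ on $\overline N$ is an action by isometries of $g_{\overline N}$.
   Context: Conventions: indices $a,b,c,\dots$ run from $1$ to $n$, indices $i,j,k,\dots$ from $0$ to $n$; repeated indices are summed. PSR manifold: let $h(t)=\frac16 k_{abc}t^at^bt^c$ ($k_{abc}\in\mathbb R$ symmetric) be a homogeneous cubic polynomial on $\mathbb R^n$. A projective special real (PSR) manifold is a hypersurface $\mathcal H\subset\{t\in\mathbb R^n\mid h(t)=1\}$ such that $g_{\mathcal H}=-\partial^2h|_{T\mathcal H\times T\mathcal H}$ is a Riemannian metric. Tree-level q-map space: put $U=\mathbb R_{>0}\cdot\mathcal H\subset\mathbb R^n$, $\overline M=\mathbb R^n+iU\subset\mathbb C^n$ with coordinates $z^a=b^a+it^a$, $z^0:=1$, $K(t)=8h(t)$, $\mathcal K=-\log K$, and $g_{\overline M}=\frac{\partial^2\mathcal K}{\partial z^a\partial\overline z^b}dz^ad\overline z^b=-\frac14\frac{\partial^2\log h}{\partial t^a\partial t^b}(db^adb^b+dt^adt^b)$. Let $\mathfrak F(X)=-h(X^1,\dots,X^n)/X^0$, $\tau_{ij}=\frac{\partial^2\mathfrak F}{\partial X^i\partial X^j}$ evaluated at $X=(1,z)$, $N_{ij}=-2\,\mathrm{Im}(\tau_{ij})$, $(N^{ij})=(N_{ij})^{-1}$, $W_i=d\widetilde\zeta_i-\tau_{ij}d\zeta^j$;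 then $K=N_{ij}z^i\overline z^j$. The tree-level q-map space is $\overline N=\overline M\times\mathbb R_{>0}\times\mathbb R^{2n+2}\times\mathbb R$ with global ("type IIA") coordinates $(z^a,\rho,\widetilde\zeta_i,\zeta^i,\sigma)$ and metric $$g_{\overline N}=g_{\overline M}+\frac{d\rho^2}{4\rho^2}-\frac1{4\rho}\Big(N^{ij}-\frac2Kz^i\overline z^j\Big)W_i\overline W_j+\frac1{64\rho^2}\big(d\sigma+\widetilde\zeta_id\zeta^i-\zeta^id\widetilde\zeta_i\big)^2 .$$ S-duality: "type IIB" global coordinates $(b^a+it^a,\tau_1+i\tau_2,c^a,c_a,c_0,\psi)$ on $\overline N$ (with $b^a+it^a\in\overline M$, $\tau_2>0$, the others real) are defined by $\rho=\frac{\tau_2^2}{2}h(t)$, $z^a=b^a+it^a$, $\zeta^0=\tau_1$, $\zeta^a=-(c^a-\tau_1b^a)$, $\widetilde\zeta_a=c_a+\frac{k_{abc}}2b^b(c^c-\tau_1b^c)$, $\widetilde\zeta_0=c_0-\frac{k_{abc}}6b^ab^b(c^c-\tau_1b^c)$, $\sigma=-2(\psi+\frac12\tau_1c_0)+c_a(c^a-\tau_1b^a)-\frac{k_{abc}}6b^ac^b(c^c-\tau_1b^c)$. The S-duality action of $\begin{pmatrix}a&b\\ c&d\end{pmatrix}\in\mathrm{SL}(2,\mathbb R)$ is, with $\tau=\tau_1+i\tau_2$, $$\tau\mapsto\frac{a\tau+b}{c\tau+d},\quad t^a\mapsto|c\tau+d|t^a,\quad c_a\mapsto c_a,\quad\begin{pmatrix}c^a\\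 b^a\end{pmatrix}\mapsto\begin{pmatrix}a&b\\ c&d\end{pmatrix}\begin{pmatrix}c^a\\ b^a\end{pmatrix},\quad\begin{pmatrix}c_0\\ \psi\end{pmatrix}\mapsto\begin{pmatrix}d&-c\\ -b&a\end{pmatrix}\begin{pmatrix}c_0\\ \psi\end{pmatrix}.$$ *)

theory Defs
  imports "HOL-Analysis.Analysis" "HOL-Algebra.Group_Action"
begin

section \<open>Smooth maps, hypersurfaces, isometries\<close>

primrec Ck_on ::
  "nat \<Rightarrow> 'a::euclidean_space set \<Rightarrow> ('a \<Rightarrow> 'b::real_normed_vector) \<Rightarrow> bool" where
  "Ck_on 0 S f \<longleftrightarrow> continuous_on S f"
| "Ck_on (Suc m) S f \<longleftrightarrow>
     (\<exists>f'. (\<forall>x\<in>S. (f has_derivative f' x) (at x)) \<and> (\<forall>v. Ck_on m S (\<lambda>x. f' x v)))"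

text \<open>The derivatives are those of the ambient Euclidean space, so this is meant for open sets.\<close>

definition smooth_on :: "'a::euclidean_space set \<Rightarrow> ('a \<Rightarrow> 'b::real_normed_vector) \<Rightarrow> bool" where
  "smooth_on S f \<longleftrightarrow> (\<forall>m. Ck_on m S f)"

definition hypersurface :: "'a::euclidean_space set \<Rightarrow> bool" where
  "hypersurface S \<longleftrightarrow>
     (\<forall>p\<in>S. \<exists>V (f :: 'a \<Rightarrow> real).
        open V \<and> p \<in> V \<and> smooth_on V f \<and>
        (\<forall>x\<in>V. \<exists>v. frechet_derivative f (at x) v \<noteq> 0) \<and>
        S \<inter> V = {x \<in> V. f x = 0})"

definition tangent_space :: "'a::real_normed_vector set \<Rightarrow> 'a \<Rightarrow> 'a set" where
  "tangent_space S p =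
     {v. \<exists>\<gamma> :: real \<Rightarrow> 'a. \<gamma> 0 = p \<and> (\<forall>\<^sub>F s in nhds 0. \<gamma> s \<in> S) \<and>
           (\<gamma> has_vector_derivative v) (at 0)}"

text \<open>Isometries of an open subset of a Euclidean space, the metric being given by
  the bilinear forms \<open>g p\<close> on the tangent spaces.\<close>

definition isometry_on ::
  "'a::euclidean_space set \<Rightarrow> ('a \<Rightarrow> 'a \<Rightarrow> 'a \<Rightarrow> real) \<Rightarrow> ('a \<Rightarrow> 'a) \<Rightarrow> bool" where
  "isometry_on N g f \<longleftrightarrow>
     bij_betw f N N \<and> smooth_on N f \<and> smooth_on N (inv_into N f) \<and>
     (\<forall>p\<in>N. \<forall>u v. g (f p) (frechet_derivative f (at p) u) (frechet_derivative f (at p) v) = g p u v)"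


section \<open>Projective special real manifolds\<close>

text \<open>The index type \<open>'n\<close> stands for \<open>{1, \<dots>, n}\<close>.  The cubic form is also used with complex
  arguments.\<close>

definition symmetric3 :: "('n \<Rightarrow> 'n \<Rightarrow> 'n \<Rightarrow> real) \<Rightarrow> bool" where
  "symmetric3 k \<longleftrightarrow> (\<forall>a b c. k b a c = k a b c \<and> k a c b = k a b c)"

definition cubic :: "('n::finite \<Rightarrow> 'n \<Rightarrow> 'n \<Rightarrow> real) \<Rightarrow> 'f::real_normed_field ^ 'n \<Rightarrow> 'f" where
  "cubic k t = (\<Sum>a\<in>UNIV. \<Sum>b\<in>UNIV. \<Sum>c\<in>UNIV. of_real (k a b c) * t $ a * t $ b * t $ c) / 6"

definition partial_deriv ::
  "'n::finite \<Rightarrow> ('f::real_normed_field ^ 'n \<Rightarrow> 'f) \<Rightarrow> 'f ^ 'n \<Rightarrow> 'f" where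
  "partial_deriv a f x = deriv (\<lambda>s. f (x + axis a s)) 0"

definition hessian :: "(real ^ 'n::finite \<Rightarrow> real) \<Rightarrow> real ^ 'n \<Rightarrow> real ^ 'n \<Rightarrow> real ^ 'n \<Rightarrow> real" where
  "hessian f x u v =
     (\<Sum>a\<in>UNIV. \<Sum>b\<in>UNIV. partial_deriv a (partial_deriv b f) x * u $ a * v $ b)"

definition psr_manifold :: "('n::finite \<Rightarrow> 'n \<Rightarrow> 'n \<Rightarrow> real) \<Rightarrow> (real ^ 'n) set \<Rightarrow> bool" where
  "psr_manifold k H \<longleftrightarrow>
     hypersurface H \<and> H \<subseteq> {t. cubic k t = 1} \<and>
     (\<forall>t\<in>H. \<forall>v\<in>tangent_space H t. v \<noteq> 0 \<longrightarrow> - hessian (cubic k) t v v > 0)"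


section \<open>The tree-level q-map space\<close>

definition cone_over :: "(real ^ 'n::finite) set \<Rightarrow> (real ^ 'n) set" where
  "cone_over H = {r *\<^sub>R t |r t. r > 0 \<and> t \<in> H}"

definition Re_vec :: "complex ^ 'n \<Rightarrow> real ^ 'n::finite" where "Re_vec z = (\<chi> a. Re (z $ a))"
definition Im_vec :: "complex ^ 'n \<Rightarrow> real ^ 'n::finite" where "Im_vec z = (\<chi> a. Im (z $ a))"

definition tube_domain :: "(real ^ 'n::finite) set \<Rightarrow> (complex ^ 'n) set" where
  "tube_domain H = {z. Im_vec z \<in> cone_over H}"

text \<open>Type IIA coordinates \<open>(z, \<rho>, \<zeta>', \<zeta>, \<sigma>)\<close>, where \<open>\<zeta>'\<close> is written for \<open>\<zeta>\<close> with a tilde.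
  The index type \<open>'n option\<close> stands for \<open>{0, \<dots>, n}\<close>, with \<open>None\<close> for \<open>0\<close>.  Since the q-map space
  is an open subset of the type \<open>'n IIA\<close>, tangent vectors are elements of the same type.\<close>

type_synonym 'n IIA =
  "(complex ^ 'n) \<times> real \<times> (real ^ ('n option)) \<times> (real ^ ('n option)) \<times> real"

definition qmap_space :: "(real ^ 'n::finite) set \<Rightarrow> 'n IIA set" where
  "qmap_space H = tube_domain H \<times> {0<..} \<times> UNIV \<times> UNIV \<times> UNIV"

text \<open>The products of one-forms in the metrics are symmetric products.\<close>

definition sym_prod :: "('v \<Rightarrow> complex) \<Rightarrow> ('v \<Rightarrow> complex) \<Rightarrow> 'v \<Rightarrow> 'v \<Rightarrow> complex" where
  "sym_prod \<alpha> \<beta> u v = (\<alpha> u * \<beta> v + \<alpha> v * \<beta> u) / 2"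

definition wirtinger :: "'n::finite \<Rightarrow> (complex ^ 'n \<Rightarrow> complex) \<Rightarrow> complex ^ 'n \<Rightarrow> complex" where
  "wirtinger a f z =
     (vector_derivative (\<lambda>s. f (z + axis a (of_real s))) (at 0) -
      \<i> * vector_derivative (\<lambda>s. f (z + axis a (\<i> * of_real s))) (at 0)) / 2"

definition wirtinger_cnj :: "'n::finite \<Rightarrow> (complex ^ 'n \<Rightarrow> complex) \<Rightarrow> complex ^ 'n \<Rightarrow> complex" where
  "wirtinger_cnj a f z =
     (vector_derivative (\<lambda>s. f (z + axis a (of_real s))) (at 0) +
      \<i> * vector_derivative (\<lambda>s. f (z + axis a (\<i> * of_real s))) (at 0)) / 2"

definition K_fun :: "('n::finite \<Rightarrow> 'n \<Rightarrow> 'n \<Rightarrow> real) \<Rightarrow> real ^ 'n \<Rightarrow> real" where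
  "K_fun k t = 8 * cubic k t"

definition kahler_potential :: "('n::finite \<Rightarrow> 'n \<Rightarrow> 'n \<Rightarrow> real) \<Rightarrow> complex ^ 'n \<Rightarrow> real" where
  "kahler_potential k z = - ln (K_fun k (Im_vec z))"

text \<open>Here and in \<open>qmap_metric\<close>, the number under \<open>Re\<close> is real, because the coefficient
  matrices are Hermitian.\<close>

definition tube_metric ::
  "('n::finite \<Rightarrow> 'n \<Rightarrow> 'n \<Rightarrow> real) \<Rightarrow> complex ^ 'n \<Rightarrow> complex ^ 'n \<Rightarrow> complex ^ 'n \<Rightarrow> real" where
  "tube_metric k z u v =
     Re (\<Sum>a\<in>UNIV. \<Sum>b\<in>UNIV.
           wirtinger a (wirtinger_cnj b (\<lambda>w. of_real (kahler_potential k w))) z *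
           sym_prod (\<lambda>w. w $ a) (\<lambda>w. cnj (w $ b)) u v)"

definition prepotential ::
  "('n::finite \<Rightarrow> 'n \<Rightarrow> 'n \<Rightarrow> real) \<Rightarrow> complex ^ ('n option) \<Rightarrow> complex" where
  "prepotential k X = - cubic k (\<chi> a. X $ Some a) / X $ None"

definition homog :: "complex ^ 'n::finite \<Rightarrow> complex ^ ('n option)" where
  "homog z = (\<chi> i. case i of None \<Rightarrow> 1 | Some a \<Rightarrow> z $ a)"

definition period_matrix ::
  "('n::finite \<Rightarrow> 'n \<Rightarrow> 'n \<Rightarrow> real) \<Rightarrow> complex ^ 'n \<Rightarrow> complex ^ ('n option) ^ ('n option)" where
  "period_matrix k z =
     (\<chi> i j. partial_deriv i (partial_deriv j (prepotential k)) (homog z))"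

definition N_matrix ::
  "('n::finite \<Rightarrow> 'n \<Rightarrow> 'n \<Rightarrow> real) \<Rightarrow> complex ^ 'n \<Rightarrow> real ^ ('n option) ^ ('n option)" where
  "N_matrix k z = (\<chi> i j. - 2 * Im (period_matrix k z $ i $ j))"

definition W_form ::
  "('n::finite \<Rightarrow> 'n \<Rightarrow> 'n \<Rightarrow> real) \<Rightarrow> complex ^ 'n \<Rightarrow> 'n option \<Rightarrow> 'n IIA \<Rightarrow> complex" where
  "W_form k z i = (\<lambda>(dz, d\<rho>, d\<zeta>', d\<zeta>, d\<sigma>).
     of_real (d\<zeta>' $ i) - (\<Sum>j\<in>UNIV. period_matrix k z $ i $ j * of_real (d\<zeta> $ j)))"

definition sigma_form :: "'n::finite IIA \<Rightarrow> 'n IIA \<Rightarrow> real" where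
  "sigma_form = (\<lambda>(z, \<rho>, \<zeta>', \<zeta>, \<sigma>) (dz, d\<rho>, d\<zeta>', d\<zeta>, d\<sigma>).
     d\<sigma> + (\<Sum>i\<in>UNIV. \<zeta>' $ i * d\<zeta> $ i) - (\<Sum>i\<in>UNIV. \<zeta> $ i * d\<zeta>' $ i))"

definition qmap_metric ::
  "('n::finite \<Rightarrow> 'n \<Rightarrow> 'n \<Rightarrow> real) \<Rightarrow> 'n IIA \<Rightarrow> 'n IIA \<Rightarrow> 'n IIA \<Rightarrow> real" where
  "qmap_metric k p u v =
     (let z = fst p; \<rho> = fst (snd p); Z = homog z;
          Ninv = matrix_inv (N_matrix k z); K = K_fun k (Im_vec z);
          dz = fst; d\<rho> = (\<lambda>w. fst (snd w))
      in tube_metric k z (dz u) (dz v)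
         + d\<rho> u * d\<rho> v / (4 * \<rho>\<^sup>2)
         - 1 / (4 * \<rho>) *
             Re (\<Sum>i\<in>UNIV. \<Sum>j\<in>UNIV.
                   (of_real (Ninv $ i $ j) - of_real (2 / K) * Z $ i * cnj (Z $ j)) *
                   sym_prod (W_form k z i) (\<lambda>w. cnj (W_form k z j w)) u v)
         + 1 / (64 * \<rho>\<^sup>2) * sigma_form p u * sigma_form p v)"


section \<open>S-duality\<close>

text \<open>Type IIB coordinates \<open>(z, \<tau>, cu, cl, c0, \<psi>)\<close>, with \<open>z = b + i t\<close>, \<open>cu\<close> for the \<open>c\<^sup>a\<close>
  and \<open>cl\<close> for the \<open>c\<^sub>a\<close>.\<close>

type_synonym 'n IIB =
  "(complex ^ 'n) \<times> complex \<times> (real ^ 'n) \<times> (real ^ 'n) \<times> real \<times> real"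

definition IIB_domain :: "(real ^ 'n::finite) set \<Rightarrow> 'n IIB set" where
  "IIB_domain H = tube_domain H \<times> {\<tau>. Im \<tau> > 0} \<times> UNIV \<times> UNIV \<times> UNIV \<times> UNIV"

definition IIA_of_IIB :: "('n::finite \<Rightarrow> 'n \<Rightarrow> 'n \<Rightarrow> real) \<Rightarrow> 'n IIB \<Rightarrow> 'n IIA" where
  "IIA_of_IIB k = (\<lambda>(z, \<tau>, cu, cl, c0, \<psi>).
     let b = Re_vec z; t = Im_vec z; \<tau>1 = Re \<tau>; \<tau>2 = Im \<tau>
     in (z,
         \<tau>2\<^sup>2 / 2 * cubic k t,
         (\<chi> i. case i of
             None \<Rightarrow> c0 - (\<Sum>a\<in>UNIV. \<Sum>b'\<in>UNIV. \<Sum>c\<in>UNIV.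
                            k a b' c / 6 * b $ a * b $ b' * (cu $ c - \<tau>1 * b $ c))
           | Some a \<Rightarrow> cl $ a + (\<Sum>b'\<in>UNIV. \<Sum>c\<in>UNIV. k a b' c / 2 * b $ b' * (cu $ c - \<tau>1 * b $ c))),
         (\<chi> i. case i of None \<Rightarrow> \<tau>1 | Some a \<Rightarrow> - (cu $ a - \<tau>1 * b $ a)),
         - 2 * (\<psi> + 1 / 2 * \<tau>1 * c0)
           + (\<Sum>a\<in>UNIV. cl $ a * (cu $ a - \<tau>1 * b $ a))
           - (\<Sum>a\<in>UNIV. \<Sum>b'\<in>UNIV. \<Sum>c\<in>UNIV.
                k a b' c / 6 * b $ a * cu $ b' * (cu $ c - \<tau>1 * b $ c))))"

definition SL2R :: "(real ^ 2 ^ 2) monoid" where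
  "SL2R = \<lparr>carrier = {A. det A = 1}, mult = (\<lambda>A B. A ** B), one = mat 1\<rparr>"

definition S_duality_IIB :: "real ^ 2 ^ 2 \<Rightarrow> 'n::finite IIB \<Rightarrow> 'n IIB" where
  "S_duality_IIB A = (\<lambda>(z, \<tau>, cu, cl, c0, \<psi>).
     let a = A $ 1 $ 1; b = A $ 1 $ 2; c = A $ 2 $ 1; d = A $ 2 $ 2
     in ((\<chi> i. Complex (c * cu $ i + d * Re (z $ i))
                       (cmod (of_real c * \<tau> + of_real d) * Im (z $ i))),
         (of_real a * \<tau> + of_real b) / (of_real c * \<tau> + of_real d),
         (\<chi> i. a * cu $ i + b * Re (z $ i)),
         cl,
         d * c0 - c * \<psi>,
         - b * c0 + a * \<psi>))"

lemma cubic_pos_on_cone: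
  assumes "psr_manifold k H" and "t \<in> cone_over H"
  shows "cubic k t > 0"
proof -
  obtain r s where t: "t = r *\<^sub>R s" "r > 0" "s \<in> H"
    using assms(2) unfolding cone_over_def by blast
  have "cubic k t = r ^ 3 * cubic k s"
    unfolding t cubic_def
    by (simp add: sum_distrib_left sum_divide_distrib power3_eq_cube mult_ac)
  moreover have "cubic k s = 1" using assms(1) t(3) unfolding psr_manifold_def by blast
  ultimately show ?thesis using t(2) by simp
qed

text \<open>The type IIB coordinates are global ones on the q-map space.\<close>

lemma IIA_of_IIB_bij_betw:
  assumes "psr_manifold k H"
  shows "bij_betw (IIA_of_IIB k) (IIB_domain H) (qmap_space H)"
proof -
  define inverse_map :: "'a IIA \<Rightarrow> 'a IIB" where
    "inverse_map = (\<lambda>(z, \<rho>, \<zeta>', \<zeta>, \<sigma>).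
       let b = Re_vec z; \<tau>1 = \<zeta> $ None;
           x = (\<chi> a. - \<zeta> $ Some a);
           cu = (\<chi> a. x $ a + \<tau>1 * b $ a);
           cl = (\<chi> a. \<zeta>' $ Some a - (\<Sum>b'\<in>UNIV. \<Sum>c\<in>UNIV. k a b' c / 2 * b $ b' * x $ c));
           c0 = \<zeta>' $ None + (\<Sum>a\<in>UNIV. \<Sum>b'\<in>UNIV. \<Sum>c\<in>UNIV.
                                k a b' c / 6 * b $ a * b $ b' * x $ c)
       in (z, Complex \<tau>1 (sqrt (2 * \<rho> / cubic k (Im_vec z))), cu, cl, c0,
           ((\<Sum>a\<in>UNIV. cl $ a * x $ a)
            - (\<Sum>a\<in>UNIV. \<Sum>b'\<in>UNIV. \<Sum>c\<in>UNIV. k a b' c / 6 * b $ a * cu $ b' * x $ c)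
            - \<sigma>) / 2 - 1 / 2 * \<tau>1 * c0))"
  have left: "inverse_map (IIA_of_IIB k p) = p" if "p \<in> IIB_domain H" for p
  proof -
    obtain z \<tau> cu cl c0 \<psi> where p: "p = (z, \<tau>, cu, cl, c0, \<psi>)" by (cases p)
    have "cubic k (Im_vec z) > 0" "Im \<tau> > 0"
      using that cubic_pos_on_cone[OF assms] unfolding p IIB_domain_def tube_domain_def by auto
    then show ?thesis
      unfolding p inverse_map_def IIA_of_IIB_def Let_def
      by (simp add: vec_eq_iff complex_eq_iff diff_divide_distrib add_divide_distrib del: minus_diff_eq)
  qed
  have right: "IIA_of_IIB k (inverse_map p) = p" if "p \<in> qmap_space H" for p
  proof -
    obtain z \<rho> \<zeta>' \<zeta> \<sigma> where p: "p = (z, \<rho>, \<zeta>', \<zeta>, \<sigma>)" by (cases p)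
    have "cubic k (Im_vec z) > 0" "\<rho> > 0"
      using that cubic_pos_on_cone[OF assms] unfolding p qmap_space_def tube_domain_def by auto
    then show ?thesis
      unfolding p inverse_map_def IIA_of_IIB_def Let_def
      by (simp add: vec_eq_iff diff_divide_distrib split: option.split)
  qed
  have "IIA_of_IIB k ` IIB_domain H \<subseteq> qmap_space H"
    using cubic_pos_on_cone[OF assms]
    by (auto simp: IIB_domain_def qmap_space_def tube_domain_def IIA_of_IIB_def Let_def)
  moreover have "inverse_map ` qmap_space H \<subseteq> IIB_domain H"
    using cubic_pos_on_cone[OF assms]
    by (auto simp: IIB_domain_def qmap_space_def tube_domain_def inverse_map_def Let_def)
  ultimately show ?thesis
    using left right by (intro bij_betw_byWitness[where f' = inverse_map]) auto
qed

text \<open>The action on the q-map space, as an extensional function (as \<open>group_action\<close> requires).\<close>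

definition S_duality ::
  "('n::finite \<Rightarrow> 'n \<Rightarrow> 'n \<Rightarrow> real) \<Rightarrow> (real ^ 'n) set \<Rightarrow> real ^ 2 ^ 2 \<Rightarrow> 'n IIA \<Rightarrow> 'n IIA" where
  "S_duality k H A = (\<lambda>p \<in> qmap_space H.
     IIA_of_IIB k (S_duality_IIB A (inv_into (IIB_domain H) (IIA_of_IIB k) p)))"

end

theory Submission
  imports Defs
begin

text \<open>
  Put \<open>\<kappa> = k(cu, db) - k(b, dcu)\<close> and write \<open>h\<close> for the cubic polynomial
  and \<open>G\<^sub>t\<close> for minus a quarter of the Hessian of \<open>log h\<close> at \<open>t\<close>.  The matrix \<open>N\<close> becomes
  block diagonal after the shift \<open>X\<^sup>a - b\<^sup>a X\<^sup>0\<close>, with blocks \<open>-4 h\<close> and \<open>2 k(t, -, -)\<close>; so its inverse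
  is explicit, once the PSR condition has been used to invert \<open>k(t, -, -)\<close>.  In type IIB coordinates the
  metric then turns out to be
  \<open>G\<^sub>t(\<nu>) + (k(t,t,\<nu>)/4h)\<^sup>2 + |d\<tau>|\<^sup>2/4\<tau>\<^sub>2\<^sup>2 + G\<^sub>t(dcu - \<tau> db)/\<tau>\<^sub>2\<^sup>2
  - (k(t,-,-)\<^sup>-\<^sup>1(\<omega>, \<omega>) - (t\<omega>)\<^sup>2/2h)/4\<tau>\<^sub>2\<^sup>2h + |\<beta> + \<tau>\<alpha>|\<^sup>2/4\<tau>\<^sub>2\<^sup>4h\<^sup>2\<close>
  (the fourth summand being Hermitian), where \<open>\<nu> = dt + t d\<tau>\<^sub>2/2\<tau>\<^sub>2\<close>, \<open>\<omega> = dcl + \<kappa>/2\<close>,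
  \<open>\<alpha> = dc0 + b (dcl + \<kappa>/6)\<close>, \<open>\<beta> = d\<psi> - cu (dcl + \<kappa>/6)\<close>.  Under S-duality \<open>\<kappa>\<close> and \<open>\<omega>\<close> are
  invariant, \<open>\<nu>\<close> and \<open>t\<close> are multiplied by \<open>|c\<tau> + d|\<close>, and \<open>dcu - \<tau> db\<close> and \<open>\<beta> + \<tau>\<alpha>\<close> are divided
  by \<open>c\<tau> + d\<close>, so that each summand is invariant.
\<close>

section \<open>Smooth maps\<close>

lemma Ck_on_Suc_imp: "Ck_on (Suc m) S f \<Longrightarrow> Ck_on m S f"
proof (induction m arbitrary: f)
  case 0
  then show ?case
    by (auto intro!: continuous_at_imp_continuous_on dest: has_derivative_continuous)
next
  case (Suc m)
  obtain f' where "\<forall>x\<in>S. (f has_derivative f' x) (at x)" "\<forall>v. Ck_on (Suc m) S (\<lambda>x. f' x v)"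
    using Suc.prems by auto
  then show ?case using Suc.IH by auto
qed

lemma Ck_on_const [simp]: "Ck_on m S (\<lambda>x. c)"
proof (induction m arbitrary: c)
  case (Suc m)
  then show ?case unfolding Ck_on.simps
    by (intro exI[where x = "\<lambda>_ _. 0"]) simp
qed simp

lemma Ck_on_bounded_linear:
  assumes "bounded_linear L"
  shows "Ck_on m S f \<Longrightarrow> Ck_on m S (\<lambda>x. L (f x))"
proof (induction m arbitrary: f)
  case 0
  then show ?case using assms by (auto intro: bounded_linear.continuous_on)
next
  case (Suc m)
  obtain f' where "\<forall>x\<in>S. (f has_derivative f' x) (at x)" "\<forall>v. Ck_on m S (\<lambda>x. f' x v)"
    using Suc.prems by auto
  then show ?case
    unfolding Ck_on.simps
    by (intro exI[where x = "\<lambda>x v. L (f' x v)"] conjI ballI allI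
        bounded_linear.has_derivative[OF assms] Suc.IH) simp_all
qed

lemma Ck_on_ident: "Ck_on m S (\<lambda>x. x)"
proof (cases m)
  case (Suc m')
  then show ?thesis
    by (auto intro!: exI[where x = "\<lambda>_ v. v"] derivative_eq_intros)
qed (auto intro: continuous_on_id)

lemma Ck_on_add: "Ck_on m S f \<Longrightarrow> Ck_on m S g \<Longrightarrow> Ck_on m S (\<lambda>x. f x + g x)"
proof (induction m arbitrary: f g)
  case 0
  then show ?case by (auto intro: continuous_on_add)
next
  case (Suc m)
  obtain f' where "\<forall>x\<in>S. (f has_derivative f' x) (at x)" "\<forall>v. Ck_on m S (\<lambda>x. f' x v)"
    using Suc.prems by auto
  moreover obtain g' where "\<forall>x\<in>S. (g has_derivative g' x) (at x)" "\<forall>v. Ck_on m S (\<lambda>x. g' x v)"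
    using Suc.prems by auto
  ultimately show ?case
    unfolding Ck_on.simps
    by (intro exI[where x = "\<lambda>x v. f' x v + g' x v"] conjI ballI allI has_derivative_add Suc.IH) simp_all
qed

lemma Ck_on_sum:
  "(\<And>i. i \<in> I \<Longrightarrow> Ck_on m S (f i)) \<Longrightarrow> Ck_on m S (\<lambda>x. \<Sum>i\<in>I. f i x)"
  by (induction I rule: infinite_finite_induct) (auto intro!: Ck_on_add)

lemma Ck_on_bounded_bilinear:
  assumes "bounded_bilinear B"
  shows "Ck_on m S f \<Longrightarrow> Ck_on m S g \<Longrightarrow> Ck_on m S (\<lambda>x. B (f x) (g x))"
proof (induction m arbitrary: f g)
  case 0
  then show ?case using assms by (auto intro: bounded_bilinear.continuous_on)
next
  case (Suc m)
  obtain f' where f': "\<forall>x\<in>S. (f has_derivative f' x) (at x)" "\<forall>v. Ck_on m S (\<lambda>x. f' x v)"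
    using Suc.prems by auto
  obtain g' where g': "\<forall>x\<in>S. (g has_derivative g' x) (at x)" "\<forall>v. Ck_on m S (\<lambda>x. g' x v)"
    using Suc.prems by auto
  \<comment> \<open>In each Leibniz term one factor stays undifferentiated, so its order is lowered
    from \<open>Suc m\<close> to \<open>m\<close> to fit the induction hypothesis.\<close>
  have "Ck_on m S f" "Ck_on m S g" using Suc.prems Ck_on_Suc_imp by blast+
  then show ?case
    unfolding Ck_on.simps using f' g'
    by (intro exI[where x = "\<lambda>x v. B (f x) (g' x v) + B (f' x v) (g x)"] conjI ballI allI
        bounded_bilinear.FDERIV[OF assms] Ck_on_add Suc.IH) simp_all
qed

lemma Ck_on_compose:
  fixes g :: "'b::euclidean_space \<Rightarrow> 'c::real_normed_vector"
  shows "Ck_on m T g \<Longrightarrow> Ck_on m S f \<Longrightarrow> f ` S \<subseteq> T \<Longrightarrow> Ck_on m S (\<lambda>x. g (f x))"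
proof (induction m arbitrary: g f)
  case 0
  then show ?case by (auto intro: continuous_on_compose2)
next
  case (Suc m)
  obtain f' where f': "\<forall>x\<in>S. (f has_derivative f' x) (at x)" "\<And>v. Ck_on m S (\<lambda>x. f' x v)"
    using Suc.prems by auto
  obtain g' where g': "\<forall>x\<in>T. (g has_derivative g' x) (at x)" "\<And>v. Ck_on m T (\<lambda>x. g' x v)"
    using Suc.prems by auto
  have f: "Ck_on m S f" using Suc.prems Ck_on_Suc_imp by blast
  define D where "D x v = (\<Sum>b\<in>Basis. (f' x v \<bullet> b) *\<^sub>R g' (f x) b)" for x v
  have "((\<lambda>x. g (f x)) has_derivative D x) (at x)" if "x \<in> S" for x
  proof -
    have "f x \<in> T" using that Suc.prems by auto
    then have g'x: "(g has_derivative g' (f x)) (at (f x))" using g' by auto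
    then interpret bounded_linear "g' (f x)" by (rule has_derivative_bounded_linear)
    have "D x v = g' (f x) (\<Sum>b\<in>Basis. (f' x v \<bullet> b) *\<^sub>R b)" for v
      unfolding D_def by (simp add: sum scaleR)
    then have "D x = (\<lambda>v. g' (f x) (f' x v))" by (simp add: euclidean_representation fun_eq_iff)
    moreover have "(f has_derivative f' x) (at x)" using f' that by auto
    ultimately show ?thesis
      using has_derivative_compose[OF \<open>(f has_derivative f' x) (at x)\<close> g'x] by simp
  qed
  moreover have "Ck_on m S (\<lambda>x. D x v)" for v
    unfolding D_def
    by (intro Ck_on_sum Ck_on_bounded_bilinear[OF bounded_bilinear_scaleR]
        Ck_on_bounded_linear[OF bounded_linear_inner_left] f' Suc.IH[OF g'(2) f Suc.prems(3)])
  ultimately show ?case by auto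
qed

text \<open>The derivatives are those of the ambient space, so agreement on \<open>S\<close>
  determines them because \<open>S\<close> is open.\<close>

lemma Ck_on_cong:
  assumes "open S" "\<And>x. x \<in> S \<Longrightarrow> f x = g x" "Ck_on m S f"
  shows "Ck_on m S g"
proof (cases m)
  case 0
  then show ?thesis using assms continuous_on_cong[of S S f g] by simp
next
  case (Suc m')
  obtain f' where f': "\<forall>x\<in>S. (f has_derivative f' x) (at x)" "\<forall>v. Ck_on m' S (\<lambda>x. f' x v)"
    using assms(3) Suc by auto
  have "(g has_derivative f' x) (at x)" if "x \<in> S" for x
    using has_derivative_transform_within_open[of f "f' x" x UNIV S g] that f'(1) assms(1,2) by blast
  then show ?thesis unfolding Suc Ck_on.simps using f'(2) by blast
qed

text \<open>The derivative is a product of constants and copies of \<open>inverse\<close> itself, so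
  the induction on the order feeds itself. The type covers real and complex denominators at
  once.\<close>

lemma Ck_on_inverse: "Ck_on m (- {0::'a::{euclidean_space, real_normed_field}}) inverse"
proof (induction m)
  case 0
  then show ?case by (auto intro!: continuous_intros)
next
  case (Suc m)
  have "Ck_on m (- {0::'a}) (\<lambda>x. - (inverse x * v * inverse x))" for v
    by (intro Ck_on_bounded_linear[OF bounded_linear_minus[OF bounded_linear_ident]]
        Ck_on_bounded_bilinear[OF bounded_bilinear_mult] Suc Ck_on_const)
  then show ?case
    by (auto intro!: exI[where x = "\<lambda>x v. - (inverse x * v * inverse x)"]
        has_derivative_inverse' )
qed

text \<open>The derivative is expressed through \<open>inverse (sqrt x)\<close>, whose order is
  given by the induction hypothesis and composition.\<close>

lemma Ck_on_sqrt: "Ck_on m {0<..} sqrt"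
proof (induction m)
  case 0
  then show ?case by (auto intro!: continuous_intros)
next
  case (Suc m)
  have "Ck_on m {0<..} (\<lambda>x. v * (inverse (sqrt x) / 2))" for v
    by (intro Ck_on_bounded_linear[OF bounded_linear_divide]
        Ck_on_bounded_bilinear[OF bounded_bilinear_mult] Ck_on_compose[OF Ck_on_inverse] Suc Ck_on_const) auto
  moreover have "(sqrt has_derivative (\<lambda>v. v * (inverse (sqrt x) / 2))) (at x)" if "x > 0" for x
    using that by (auto intro!: derivative_eq_intros simp: field_simps)
  ultimately show ?case
    unfolding Ck_on.simps by (intro exI[where x = "\<lambda>x v. v * (inverse (sqrt x) / 2)"]) blast
qed

section \<open>Calculus of \<open>smooth_on\<close>, inherited from \<open>Ck_on\<close>\<close>

lemma smooth_on_imp_differentiable: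
  assumes "smooth_on S f" "x \<in> S"
  shows "(f has_derivative frechet_derivative f (at x)) (at x)"
proof -
  have "Ck_on (Suc 0) S f" using assms unfolding smooth_on_def by blast
  then obtain f' where "(f has_derivative f' x) (at x)"
    using assms(2) unfolding Ck_on.simps by blast
  then show ?thesis using frechet_derivative_works differentiableI by blast
qed

lemma smooth_on_imp_continuous_on: "smooth_on S f \<Longrightarrow> continuous_on S f"
  unfolding smooth_on_def by (metis Ck_on.simps(1))

lemma smooth_on_compose:
  fixes g :: "'b::euclidean_space \<Rightarrow> 'c::real_normed_vector"
  shows "smooth_on T g \<Longrightarrow> smooth_on S f \<Longrightarrow> f ` S \<subseteq> T \<Longrightarrow> smooth_on S (\<lambda>x. g (f x))"
  unfolding smooth_on_def by (intro allI Ck_on_compose[of _ T g S f]) auto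

lemma smooth_on_cong:
  "open S \<Longrightarrow> (\<And>x. x \<in> S \<Longrightarrow> f x = g x) \<Longrightarrow> smooth_on S f \<Longrightarrow> smooth_on S g"
  unfolding smooth_on_def using Ck_on_cong[of S f g] by auto

lemma smooth_on_const [simp, intro]: "smooth_on S (\<lambda>x. c)"
  unfolding smooth_on_def by auto

lemma smooth_on_ident [simp, intro]: "smooth_on S (\<lambda>x. x)"
  unfolding smooth_on_def by (auto intro: Ck_on_ident)

lemma smooth_on_add: "smooth_on S f \<Longrightarrow> smooth_on S g \<Longrightarrow> smooth_on S (\<lambda>x. f x + g x)"
  unfolding smooth_on_def using Ck_on_add[of _ S f g] by auto

lemma smooth_on_bounded_linear:
  "bounded_linear L \<Longrightarrow> smooth_on S f \<Longrightarrow> smooth_on S (\<lambda>x. L (f x))"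
  unfolding smooth_on_def using Ck_on_bounded_linear[of L _ S f] by auto

lemma smooth_on_bounded_bilinear:
  "bounded_bilinear B \<Longrightarrow> smooth_on S f \<Longrightarrow> smooth_on S g \<Longrightarrow> smooth_on S (\<lambda>x. B (f x) (g x))"
  unfolding smooth_on_def using Ck_on_bounded_bilinear[of B _ S f g] by auto

lemmas smooth_on_minus = smooth_on_bounded_linear[OF bounded_linear_minus[OF bounded_linear_ident]]
lemmas smooth_on_fst = smooth_on_bounded_linear[OF bounded_linear_fst]
lemmas smooth_on_snd = smooth_on_bounded_linear[OF bounded_linear_snd]
lemmas smooth_on_Re = smooth_on_bounded_linear[OF bounded_linear_Re]
lemmas smooth_on_Im = smooth_on_bounded_linear[OF bounded_linear_Im]
lemmas smooth_on_mult = smooth_on_bounded_bilinear[OF bounded_bilinear_mult]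
lemmas smooth_on_scaleR = smooth_on_bounded_bilinear[OF bounded_bilinear_scaleR]
lemmas smooth_on_inner = smooth_on_bounded_bilinear[OF bounded_bilinear_inner]

lemma smooth_on_diff:
  "smooth_on S f \<Longrightarrow> smooth_on S g \<Longrightarrow> smooth_on S (\<lambda>x. f x - g x)"
  using smooth_on_add[of S f "\<lambda>x. - g x"] smooth_on_minus[of S g] by simp

lemma smooth_on_power:
  fixes f :: "_ \<Rightarrow> 'b::real_normed_algebra_1"
  shows "smooth_on S f \<Longrightarrow> smooth_on S (\<lambda>x. f x ^ j)"
  by (induction j) (simp_all add: smooth_on_mult)

text \<open>A pair is the sum of the images of its entries under the linear inclusions of the two
  factors.\<close>

lemma smooth_on_Pair:
  assumes "smooth_on S f" "smooth_on S g"
  shows "smooth_on S (\<lambda>x. (f x, g x))"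
proof -
  have "smooth_on S (\<lambda>x. (f x, 0) + (0, g x))"
    by (intro smooth_on_add smooth_on_bounded_linear[OF _ assms(1)] smooth_on_bounded_linear[OF _ assms(2)]
        bounded_linear_Pair bounded_linear_ident bounded_linear_zero)
  then show ?thesis by simp
qed

lemma smooth_on_Complex:
  assumes "smooth_on S f" "smooth_on S g"
  shows "smooth_on S (\<lambda>x. Complex (f x) (g x))"
proof -
  have "smooth_on S (\<lambda>x. complex_of_real (f x) + \<i> * complex_of_real (g x))"
    by (intro smooth_on_add smooth_on_mult smooth_on_const assms
        smooth_on_bounded_linear[OF bounded_linear_of_real])
  then show ?thesis by (simp add: Complex_eq)
qed

lemma smooth_on_divide:
  fixes f g :: "_ \<Rightarrow> 'b::{euclidean_space, real_normed_field}"
  assumes "smooth_on S f" "smooth_on S g" "\<And>x. x \<in> S \<Longrightarrow> g x \<noteq> 0"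
  shows "smooth_on S (\<lambda>x. f x / g x)"
proof -
  have "smooth_on (- {0::'b}) inverse" by (simp add: smooth_on_def Ck_on_inverse)
  then have "smooth_on S (\<lambda>x. inverse (g x))"
    by (rule smooth_on_compose) (use assms in auto)
  then show ?thesis using smooth_on_mult[OF assms(1)] by (simp add: divide_inverse)
qed

lemma smooth_on_sqrt:
  fixes f :: "_ \<Rightarrow> real"
  assumes "smooth_on S f" "\<And>x. x \<in> S \<Longrightarrow> f x > 0"
  shows "smooth_on S (\<lambda>x. sqrt (f x))"
proof -
  have "smooth_on {0<..} sqrt" by (simp add: smooth_on_def Ck_on_sqrt)
  then show ?thesis by (rule smooth_on_compose) (use assms in auto)
qed

section \<open>The cubic form\<close>

text \<open>The trilinear form k(x, y, z) of the overview. The field stays general because both the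
  real \<open>t\<close> and the complex \<open>z\<close> are inserted.\<close>

definition k3 :: "('n::finite \<Rightarrow> 'n \<Rightarrow> 'n \<Rightarrow> real) \<Rightarrow>
    'f::real_normed_field ^ 'n \<Rightarrow> 'f ^ 'n \<Rightarrow> 'f ^ 'n \<Rightarrow> 'f" where
  "k3 k x y z = (\<Sum>a\<in>UNIV. \<Sum>b\<in>UNIV. \<Sum>c\<in>UNIV. of_real (k a b c) * x $ a * y $ b * z $ c)"

text \<open>The covector k(-, x, y), turned into a vector by the standard inner product, so that
  \<open>k2 k t\<close> is the linear map whose inverse enters the metric.\<close>

definition k2 :: "('n::finite \<Rightarrow> 'n \<Rightarrow> 'n \<Rightarrow> real) \<Rightarrow> real ^ 'n \<Rightarrow> real ^ 'n \<Rightarrow> real ^ 'n" where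
  "k2 k x y = (\<chi> a. \<Sum>b\<in>UNIV. \<Sum>c\<in>UNIV. k a b c * x $ b * y $ c)"

lemma k3_linear:
  "k3 k (x + x') y z = k3 k x y z + k3 k x' y z"
  "k3 k x (y + y') z = k3 k x y z + k3 k x y' z"
  "k3 k x y (z + z') = k3 k x y z + k3 k x y z'"
  "k3 k (x - x') y z = k3 k x y z - k3 k x' y z"
  "k3 k x (y - y') z = k3 k x y z - k3 k x y' z"
  "k3 k x y (z - z') = k3 k x y z - k3 k x y z'"
  "k3 k (s *s x) y z = s * k3 k x y z"
  "k3 k x (s *s y) z = s * k3 k x y z"
  "k3 k x y (s *s z) = s * k3 k x y z"
  unfolding k3_def
  by (simp_all add: algebra_simps sum.distrib sum_subtractf sum_distrib_left)

lemma k3_linear_real: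
  fixes x y z :: "real ^ 'n::finite"
  shows "k3 k (r *\<^sub>R x) y z = r * k3 k x y z"
    "k3 k x (r *\<^sub>R y) z = r * k3 k x y z"
    "k3 k x y (r *\<^sub>R z) = r * k3 k x y z"
    "k3 k (- x) y z = - k3 k x y z"
    "k3 k x (- y) z = - k3 k x y z"
    "k3 k x y (- z) = - k3 k x y z"
    "k3 k 0 y z = 0" "k3 k x 0 z = 0" "k3 k x y 0 = 0"
  unfolding k3_def
  by (simp_all add: algebra_simps sum_negf sum_distrib_left)

lemma k3_sum:
  fixes y z :: "real ^ 'n::finite"
  shows "k3 k (sum f A) y z = (\<Sum>i\<in>A. k3 k (f i) y z)"
    "k3 k y (sum f A) z = (\<Sum>i\<in>A. k3 k y (f i) z)"
  by (induction A rule: infinite_finite_induct) (simp_all add: k3_linear k3_linear_real)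

lemma k2_linear:
  "k2 k (x + x') y = k2 k x y + k2 k x' y"
  "k2 k x (y + y') = k2 k x y + k2 k x y'"
  "k2 k (x - x') y = k2 k x y - k2 k x' y"
  "k2 k x (y - y') = k2 k x y - k2 k x y'"
  "k2 k (r *\<^sub>R x) y = r *\<^sub>R k2 k x y"
  "k2 k x (r *\<^sub>R y) = r *\<^sub>R k2 k x y"
  "k2 k (- x) y = - k2 k x y"
  "k2 k x (- y) = - k2 k x y"
  unfolding k2_def vec_eq_iff
  by (simp_all add: algebra_simps sum.distrib sum_subtractf sum_distrib_left sum_negf)

lemma inner_k2:
  "x \<bullet> k2 k y z = k3 k x y z"
  "k2 k y z \<bullet> x = k3 k x y z"
  unfolding k3_def k2_def inner_vec_def by (simp_all add: sum_distrib_left sum_distrib_right mult_ac)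

lemma k3_axis: "k3 k (axis a 1) y z = k2 k y z $ a"
  by (simp add: inner_k2[symmetric] inner_axis')

lemma cubic_eq_k3: "cubic k t = k3 k t t t / 6"
  unfolding cubic_def k3_def by simp

lemma bounded_bilinear_k2: "bounded_bilinear (k2 k)"
  unfolding bilinear_conv_bounded_bilinear[symmetric] bilinear_def
  by (auto intro!: linearI simp: k2_linear)

lemmas has_derivative_k2 [derivative_intros] = bounded_bilinear.FDERIV[OF bounded_bilinear_k2]

lemma has_derivative_k3 [derivative_intros]:
  fixes f g h :: "'a::real_normed_vector \<Rightarrow> real ^ 'n::finite"
  assumes "(f has_derivative f') (at x within S)" "(g has_derivative g') (at x within S)"
    "(h has_derivative h') (at x within S)"
  shows "((\<lambda>x. k3 k (f x) (g x) (h x)) has_derivative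
    (\<lambda>v. k3 k (f' v) (g x) (h x) + k3 k (f x) (g' v) (h x) + k3 k (f x) (g x) (h' v))) (at x within S)"
  unfolding inner_k2(1)[symmetric]
  by (rule has_derivative_eq_rhs, (rule derivative_intros assms)+) (simp add: fun_eq_iff inner_add_right)

lemma cubic_scaleR: "cubic k (r *\<^sub>R t) = r ^ 3 * cubic k (t :: real ^ 'n::finite)"
  by (simp add: cubic_eq_k3 k3_linear_real power3_eq_cube)

locale symmetric_cubic =
  fixes k :: "'n::finite \<Rightarrow> 'n \<Rightarrow> 'n \<Rightarrow> real"
  assumes sym: "symmetric3 k"
begin

abbreviation "h \<equiv> cubic k :: real ^ 'n \<Rightarrow> real"

lemma k3_commute: "k3 k y x z = k3 k x y z"
proof -
  have "k b a c = k a b c" for a b c using sym unfolding symmetric3_def by blast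
  then show ?thesis
    unfolding k3_def by (subst sum.swap) (simp add: mult_ac)
qed

lemma k3_commute': "k3 k x z y = k3 k x y z"
proof -
  have "k a c b = k a b c" for a b c using sym unfolding symmetric3_def by blast
  then have "(\<Sum>b\<in>UNIV. \<Sum>c\<in>UNIV. of_real (k a b c) * x $ a * z $ b * y $ c)
      = (\<Sum>b\<in>UNIV. \<Sum>c\<in>UNIV. of_real (k a b c) * x $ a * y $ b * z $ c)" for a
    by (subst sum.swap) (simp add: mult_ac)
  then show ?thesis
    unfolding k3_def by simp
qed

lemma k3_left_commute: "k3 k x y z = k3 k z y x"
  by (metis k3_commute k3_commute')

lemmas k3_ac = k3_commute k3_commute'

lemma k2_commute: "k2 k y x = k2 k x y"
  unfolding vec_eq_iff k3_axis[symmetric] by (simp add: k3_commute')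

text \<open>The exact Taylor polynomial along a coordinate axis, by trilinearity and symmetry. Real
  and complex partial derivatives are both read off its linear term.\<close>

lemma cubic_axis:
  "cubic k (x + axis a s) =
    cubic k x + s * (k3 k (axis a 1) x x / 2) + s\<^sup>2 * (k3 k (axis a 1) (axis a 1) x / 2)
     + s ^ 3 * (k3 k (axis a 1) (axis a 1) (axis a 1) / 6)"
proof -
  have "axis a s = s *s axis a 1" by (auto simp: vec_eq_iff axis_def)
  then show ?thesis
    unfolding cubic_eq_k3 \<open>axis a s = s *s axis a 1\<close> k3_linear
    by (simp add: k3_ac power2_eq_square power3_eq_cube field_simps)
qed

lemma cubic_axis_has_field_derivative:
  "((\<lambda>s. cubic k (x + axis a s)) has_field_derivative k3 k (axis a 1) x x / 2) (at 0)"
  unfolding cubic_axis by (auto intro!: derivative_eq_intros)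

lemma k3_axis_has_field_derivative:
  fixes x y :: "'c::real_normed_field ^ 'n"
  shows "((\<lambda>s. k3 k y (x + axis a s) (x + axis a s)) has_field_derivative 2 * k3 k (axis a 1) y x) (at 0)"
proof -
  have eq: "axis a s = s *s axis a 1" for s :: 'c by (auto simp add: vec_eq_iff axis_def)
  have "k3 k y (x + axis a s) (x + axis a s) = k3 k y x x + s * (2 * k3 k (axis a 1) y x)
      + s\<^sup>2 * k3 k y (axis a 1) (axis a 1)" for s
    unfolding eq[of s] k3_linear by (simp add: k3_ac power2_eq_square algebra_simps)
  then show ?thesis by (auto intro!: derivative_eq_intros)
qed

lemma cubic_has_derivative: "(h has_derivative (\<lambda>v. k3 k v t t / 2)) (at t)"
proof -
  have "((\<lambda>t. k3 k t t t / 6) has_derivative (\<lambda>v. k3 k v t t / 2)) (at t)"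
    by (auto intro!: derivative_eq_intros simp: k3_ac)
  then show ?thesis by (simp add: cubic_eq_k3[abs_def])
qed

lemma partial_deriv_cubic: "partial_deriv a (cubic k) x = k3 k (axis a 1) x x / 2"
  unfolding partial_deriv_def by (rule DERIV_imp_deriv[OF cubic_axis_has_field_derivative])

text \<open>Translates the definiteness in \<open>psr_manifold\<close>, stated with iterated partial
  derivatives, into a statement about k(t, -, -).\<close>

lemma hessian_cubic: "hessian h t u v = k3 k t u v"
proof -
  have "partial_deriv a (partial_deriv b h) t = k3 k (axis a 1) (axis b 1) t" for a b
    unfolding partial_deriv_cubic[abs_def] unfolding partial_deriv_def
    by (rule DERIV_imp_deriv)
      (use DERIV_cdivide[OF k3_axis_has_field_derivative[of "axis b 1" t a], of 2] in simp)
  then have "hessian h t u v = (\<Sum>a\<in>UNIV. \<Sum>b\<in>UNIV. k3 k (u $ a *\<^sub>R axis a 1) (v $ b *\<^sub>R axis b 1) t)"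
    unfolding hessian_def by (simp add: k3_linear_real mult_ac)
  also have "\<dots> = k3 k (\<Sum>a\<in>UNIV. u $ a *\<^sub>R axis a 1) (\<Sum>b\<in>UNIV. v $ b *\<^sub>R axis b 1) t"
    by (simp only: k3_sum(1)) (simp only: k3_sum(2))
  also have "\<dots> = k3 k t u v"
    unfolding scalar_mult_eq_scaleR[symmetric] basis_expansion by (simp add: k3_ac)
  finally show ?thesis .
qed

end

section \<open>The cone over a projective special real manifold\<close>

locale psr = symmetric_cubic k for k :: "'n::finite \<Rightarrow> 'n \<Rightarrow> 'n \<Rightarrow> real" +
  fixes H :: "(real ^ 'n::finite) set"
  assumes psr: "psr_manifold k H"
begin

abbreviation "U \<equiv> cone_over H"

lemma cubic_on_H: "t \<in> H \<Longrightarrow> h t = 1"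
  using psr unfolding psr_manifold_def by auto

lemma H_subset_cone: "t \<in> H \<Longrightarrow> t \<in> U"
  unfolding cone_over_def by (auto intro!: exI[of _ "1::real"] exI[of _ t])

lemma h_pos: "t \<in> U \<Longrightarrow> h t > 0"
  using cubic_pos_on_cone[OF psr] .

lemma cone_scaleR: "t \<in> U \<Longrightarrow> r > 0 \<Longrightarrow> r *\<^sub>R t \<in> U"
  unfolding cone_over_def by (smt (verit) mem_Collect_eq mult_pos_pos scaleR_scaleR)

text \<open>By homogeneity of degree 3, a ray of the cone takes the value 1 only once, namely at its
  point in \<open>H\<close>.\<close>

lemma in_H_if_cubic_eq_1:
  assumes "t \<in> U" "h t = 1"
  shows "t \<in> H"
proof -
  obtain r s where t: "t = r *\<^sub>R s" "r > 0" "s \<in> H"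
    using assms(1) unfolding cone_over_def by blast
  then have "r ^ 3 = 1" using assms(2) cubic_on_H by (simp add: cubic_scaleR)
  then have "r = 1" using t(2) by (smt (verit) one_less_power power_less_one_iff zero_less_numeral power_eq_0_iff)
  then show ?thesis using t by simp
qed

text \<open>\<open>H\<close> is a hypersurface contained in a level set of \<open>h\<close>, and the derivative of \<open>h\<close> in radial
  direction is \<open>3 h\<close>; so \<open>H\<close> is transversal to the rays.\<close>

lemma radial_derivative_nonzero:
  assumes "p \<in> H" "open V" "p \<in> V" and H: "H \<inter> V = {x \<in> V. f x = 0}"
    and cont: "continuous_on V f" and f: "(f has_derivative f') (at p)" and w: "f' w \<noteq> (0::real)"
  shows "f' p \<noteq> 0"
proof
  assume f'p: "f' p = 0"
  interpret f': bounded_linear f' using f by (rule has_derivative_bounded_linear)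
  define w' where "w' = (if f' w > 0 then w else - w)"
  have w': "f' w' > 0" using w by (auto simp: w'_def f'.neg)
  \<comment> \<open>After division by \<open>c\<close>, the derivative of \<open>h\<close> at
    \<open>p\<close> along \<open>q\<close> is below 1 in absolute value, while along
    \<open>p\<close> it is 3. So \<open>h\<close> grows to first order along
    \<open>p + s *\<^sub>R q\<close> whenever \<open>\<bar>s\<bar> \<le> 1\<close>.\<close>
  define c where "c = \<bar>k3 k w' p p / 2\<bar> + 1"
  have "c > 0" by (simp add: c_def)
  define q where "q = w' /\<^sub>R c"
  have q: "f' q > 0" using w' \<open>c > 0\<close> by (simp add: q_def f'.scaleR)
  have hq: "\<bar>k3 k q p p / 2\<bar> < 1" using \<open>c > 0\<close> by (simp add: q_def k3_linear_real c_def field_simps)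
  \<comment> \<open>For a small step \<open>e\<close>, the parameter \<open>s\<close> tilts the
    direction. Since \<open>f' p = 0\<close>, the first-order change of \<open>f\<close> is
    \<open>e * s * f' q\<close>, which is positive at \<open>s = 1\<close> and negative at
    \<open>s = -1\<close>.\<close>
  define g where "g s e = p + e *\<^sub>R (p + s *\<^sub>R q)" for s e :: real
  have g: "((\<lambda>e. g s e) has_derivative (\<lambda>e. e *\<^sub>R (p + s *\<^sub>R q))) (at 0)" for s
    unfolding g_def by (auto intro!: derivative_eq_intros)
  have fg: "((\<lambda>e. f (g s e)) has_real_derivative s * f' q) (at 0)" for s
  proof -
    have "((\<lambda>e. f (g s e)) has_derivative (\<lambda>e. f' (e *\<^sub>R (p + s *\<^sub>R q)))) (at 0)"
      by (rule has_derivative_compose[OF g, of f]) (use f in \<open>simp add: g_def\<close>)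
    then show ?thesis
      by (simp add: f'.scaleR f'.add f'p has_field_derivative_def mult_commute_abs)
  qed
  have f0: "f (g s 0) = 0" for s using assms(1,3) H by (auto simp: g_def)
  obtain d1 where d1: "d1 > 0" "\<And>e. 0 < e \<Longrightarrow> e < d1 \<Longrightarrow> f (g 1 e) > 0"
    using DERIV_pos_inc_right[OF fg[of 1]] q f0 by auto
  obtain d2 where d2: "d2 > 0" "\<And>e. 0 < e \<Longrightarrow> e < d2 \<Longrightarrow> f (g (-1) e) < 0"
    using DERIV_neg_dec_right[OF fg[of "-1"]] q f0 by auto
  obtain d3 where d3: "d3 > 0" "\<And>y. dist y p < d3 \<Longrightarrow> y \<in> V"
    using assms(2,3) by (auto simp: open_dist)
  define l where "l = norm p + norm q + 1"
  have l: "l > 0" by (auto simp: l_def intro: add_nonneg_pos)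
  \<comment> \<open>A lower bound for the derivative of \<open>h\<close> at \<open>p\<close> along
    all the directions \<open>p + s *\<^sub>R q\<close> with
    \<open>\<bar>s\<bar> \<le> 1\<close>.\<close>
  define m where "m = 3 - \<bar>3 * (k3 k q p p / 6)\<bar>"
  have "m > 0" using hq by (simp add: m_def)
  obtain d4 where d4: "d4 > 0"
    "\<And>y. norm (y - p) < d4 \<Longrightarrow> norm (h y - h p - k3 k (y - p) p p / 2) \<le> (m / l) * norm (y - p)"
    using cubic_has_derivative[of p] \<open>m > 0\<close> l unfolding has_derivative_at_alt
    by (meson divide_pos_pos)
  define \<delta> where "\<delta> = Min {d1, d2, d3 / l, d4 / l}"
  have \<delta>: "\<delta> > 0" "\<delta> \<le> d1" "\<delta> \<le> d2" "\<delta> \<le> d3 / l" "\<delta> \<le> d4 / l"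
    using d1(1) d2(1) d3(1) d4(1) l by (simp_all add: \<delta>_def)
  define e where "e = \<delta> / 2"
  have e: "0 < e" "e < d1" "e < d2" "e < d3 / l" "e < d4 / l"
    using \<delta> unfolding e_def by linarith+
  have bound: "norm (g s e - p) < l * e" if "\<bar>s\<bar> \<le> 1" for s
  proof -
    have "norm (p + s *\<^sub>R q) \<le> norm p + norm q"
      by (rule order_trans[OF norm_triangle_ineq]) (use that in \<open>simp add: mult_left_le_one_le\<close>)
    also have "\<dots> < l" by (simp add: l_def)
    finally show ?thesis using e(1) by (simp add: g_def mult.commute)
  qed
  have gV: "g s e \<in> V" if "\<bar>s\<bar> \<le> 1" for s
    using bound[OF that] e(4) l by (intro d3(2)) (simp add: dist_norm field_simps)
  have "continuous_on {-1..1} (\<lambda>s. f (g s e))"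
  proof (rule continuous_on_compose2[OF cont])
    show "continuous_on {-1..1} (\<lambda>s. g s e)" unfolding g_def by (intro continuous_intros)
    show "(\<lambda>s. g s e) ` {-1..1} \<subseteq> V" using gV by auto
  qed
  \<comment> \<open>The intermediate value theorem in \<open>s\<close> produces a point of
    \<open>H\<close>, where \<open>h\<close> is again 1. The linear term of \<open>h\<close> would
    then equal its remainder up to sign, but the former is at least \<open>m * e\<close> and the
    latter is smaller.\<close>
  then obtain s where s: "-1 \<le> s" "s \<le> 1" "f (g s e) = 0"
    using IVT'[of "\<lambda>s. f (g s e)" "-1" 0 1] d1(2)[OF e(1,2)] d2(2)[OF e(1,3)] by auto
  have s1: "\<bar>s\<bar> \<le> 1" using s by auto
  have "g s e \<in> H \<inter> V" using s unfolding H using gV[OF s1] by simp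
  then have "g s e \<in> H" by simp
  then have "h (g s e) = 1" "h p = 1" using assms(1) cubic_on_H by auto
  moreover have "norm (g s e - p) < d4" using bound[OF s1] e(5) l by (simp add: field_simps)
  ultimately have "\<bar>k3 k (g s e - p) p p / 2\<bar> \<le> (m / l) * norm (g s e - p)"
    using d4(2)[of "g s e"] by simp
  also have "\<dots> < (m / l) * (l * e)"
    using bound[OF s1] \<open>m > 0\<close> l by (intro mult_strict_left_mono) auto
  finally have "\<bar>k3 k (g s e - p) p p / 2\<bar> < m * e" using l by simp
  moreover have "k3 k (g s e - p) p p / 2 = e * (3 + s * (k3 k q p p / 2))"
    using \<open>h p = 1\<close> by (simp add: g_def k3_linear k3_linear_real cubic_eq_k3 algebra_simps)
  moreover have "\<bar>s * (k3 k q p p / 2)\<bar> \<le> \<bar>3 * (k3 k q p p / 6)\<bar>"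
    using s mult_right_mono[of "\<bar>s\<bar>" 1 "\<bar>k3 k q p p\<bar>"] by (simp add: abs_mult)
  then have "m \<le> 3 + s * (k3 k q p p / 2)" unfolding m_def by linarith
  then have "e * m \<le> e * (3 + s * (k3 k q p p / 2))" using e(1) by simp
  ultimately show False by (simp add: mult.commute)
qed

text \<open>As the radial derivative of \<open>f\<close> at \<open>p\<close> is nonzero,
  \<open>f\<close> changes sign between (1 - e) x and (1 + e) x for every \<open>x\<close> near
  \<open>p\<close>. So the ray through each such \<open>x\<close> meets \<open>H\<close>.\<close>

lemma cone_neighbourhood:
  assumes "p \<in> H"
  shows "\<exists>W. open W \<and> p \<in> W \<and> W \<subseteq> U"
proof -
  obtain V f where V: "open V" "p \<in> V" "smooth_on V f"
    "\<forall>x\<in>V. \<exists>v. frechet_derivative f (at x) v \<noteq> (0::real)" "H \<inter> V = {x \<in> V. f x = 0}"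
    using psr assms unfolding psr_manifold_def hypersurface_def by meson
  define f' where "f' = frechet_derivative f (at p)"
  have f: "(f has_derivative f') (at p)"
    unfolding f'_def by (rule smooth_on_imp_differentiable[OF V(3,2)])
  interpret f': bounded_linear f' using f by (rule has_derivative_bounded_linear)
  have cont: "continuous_on V f" by (rule smooth_on_imp_continuous_on[OF V(3)])
  obtain w where "f' w \<noteq> 0" using V(2,4) unfolding f'_def by blast
  then have "f' p \<noteq> 0" using radial_derivative_nonzero[OF assms V(1,2,5) cont f] by blast
  \<comment> \<open>The sign is chosen so that \<open>g\<close> increases along the ray at
    \<open>p\<close>.\<close>
  define g where "g x = (if f' p > 0 then f x else - f x)" for x
  have g: "continuous_on V g" using cont unfolding g_def by (cases "f' p > 0") (auto intro: continuous_intros)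
  have "f p = 0" using assms V(2,5) by auto
  then have g0: "g p = 0" by (simp add: g_def)
  have "((\<lambda>e. p + e *\<^sub>R p) has_derivative (\<lambda>e. e *\<^sub>R p)) (at 0)"
    by (auto intro!: derivative_eq_intros)
  then have "((\<lambda>e. f (p + e *\<^sub>R p)) has_derivative (\<lambda>e. f' (e *\<^sub>R p))) (at 0)"
    by (rule has_derivative_compose) (use f in simp)
  then have "((\<lambda>e. f (p + e *\<^sub>R p)) has_real_derivative f' p) (at 0)"
    by (simp add: f'.scaleR has_field_derivative_def mult_commute_abs)
  then have gd: "((\<lambda>e. g (p + e *\<^sub>R p)) has_real_derivative \<bar>f' p\<bar>) (at 0)"
    using \<open>f' p \<noteq> 0\<close> DERIV_minus unfolding g_def by (cases "f' p > 0") fastforce+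
  obtain d1 where d1: "d1 > 0" "\<And>e. 0 < e \<Longrightarrow> e < d1 \<Longrightarrow> g (p + e *\<^sub>R p) > 0"
    using DERIV_pos_inc_right[OF gd] g0 \<open>f' p \<noteq> 0\<close> by auto
  obtain d2 where d2: "d2 > 0" "\<And>e. 0 < e \<Longrightarrow> e < d2 \<Longrightarrow> g (p - e *\<^sub>R p) < 0"
    using DERIV_pos_inc_left[OF gd] g0 \<open>f' p \<noteq> 0\<close> by auto
  obtain d3 where d3: "d3 > 0" "\<And>y. dist y p < d3 \<Longrightarrow> y \<in> V"
    using V(1,2) by (auto simp: open_dist)
  define l where "l = norm p + 1"
  have l: "l > 0" by (auto simp: l_def intro: add_nonneg_pos)
  define \<delta> where "\<delta> = Min {d1, d2, d3 / l, 1}"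
  have \<delta>: "\<delta> > 0" "\<delta> \<le> d1" "\<delta> \<le> d2" "\<delta> \<le> d3 / l" "\<delta> \<le> 1"
    using d1(1) d2(1) d3(1) l by (simp_all add: \<delta>_def)
  define e where "e = \<delta> / 2"
  have e: "0 < e" "e < d1" "e < d2" "e < d3 / l" "e < 1"
    using \<delta> unfolding e_def by linarith+
  have en: "e * norm p < d3"
  proof -
    have "e * norm p \<le> e * l" using e(1) by (simp add: l_def)
    also have "\<dots> < d3" using e(4) l by (simp add: field_simps)
    finally show ?thesis .
  qed
  \<comment> \<open>The radius comes from writing (1 + s) x - p as (1 + s) (x - p) + s p, where 1 +
    s is at most 2: all the rescaled points stay within distance \<open>d3\<close> of
    \<open>p\<close>.\<close>
  define B where "B = ball p ((d3 - e * norm p) / 2)"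
  have BV: "x + s *\<^sub>R x \<in> V" if "x \<in> B" "\<bar>s\<bar> \<le> e" for x s
  proof (rule d3(2))
    have "dist (x + s *\<^sub>R x) p = norm ((1 + s) *\<^sub>R (x - p) + s *\<^sub>R p)"
      by (simp add: dist_norm algebra_simps)
    also have "\<dots> \<le> \<bar>1 + s\<bar> * norm (x - p) + \<bar>s\<bar> * norm p"
      by (rule order_trans[OF norm_triangle_ineq]) simp
    also have "\<dots> \<le> 2 * norm (x - p) + e * norm p"
      using that(2) e(5) by (intro add_mono mult_right_mono) auto
    also have "\<dots> < d3" using that(1) by (simp add: B_def dist_norm norm_minus_commute)
    finally show "dist (x + s *\<^sub>R x) p < d3" .
  qed
  have pB: "p \<in> B" using en by (simp add: B_def)
  have oB: "open B" by (simp add: B_def)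
  have cB: "continuous_on B (\<lambda>x. g (x + s *\<^sub>R x))" if "\<bar>s\<bar> \<le> e" for s
    by (rule continuous_on_compose2[OF g]) (use that BV in \<open>auto intro!: continuous_intros\<close>)
  define W where "W = (B \<inter> (\<lambda>x. g (x + e *\<^sub>R x)) -` {0<..}) \<inter> (B \<inter> (\<lambda>x. g (x + (- e) *\<^sub>R x)) -` {..<0})"
  have "open W" unfolding W_def
    by (intro open_Int continuous_open_preimage[OF cB oB]) (use e(1) in auto)
  moreover have "p \<in> W" using pB d1(2) d2(2) e by (simp add: W_def)
  moreover have "W \<subseteq> U"
  proof
    fix x assume x: "x \<in> W"
    have "continuous_on {-e..e} (\<lambda>s. g (x + s *\<^sub>R x))"
      by (rule continuous_on_compose2[OF g]) (use x BV in \<open>auto intro!: continuous_intros simp: W_def\<close>)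
    then obtain s where s: "- e \<le> s" "s \<le> e" "g (x + s *\<^sub>R x) = 0"
      using IVT'[of "\<lambda>s. g (x + s *\<^sub>R x)" "-e" 0 e] x e(1) unfolding W_def by auto
    then have "f (x + s *\<^sub>R x) = 0" by (simp add: g_def split: if_splits)
    moreover have "x + s *\<^sub>R x \<in> V" using BV x s by (auto simp: W_def)
    ultimately have "x + s *\<^sub>R x \<in> H" using V(5) by auto
    then have "(1 / (1 + s)) *\<^sub>R (x + s *\<^sub>R x) \<in> U"
      using s e(5) by (intro cone_scaleR H_subset_cone) auto
    moreover have "(1 / (1 + s)) *\<^sub>R (x + s *\<^sub>R x) = (1 / (1 + s) * (1 + s)) *\<^sub>R x"
      by (simp only: scaleR_scaleR[symmetric] scaleR_left.add scaleR_one)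
    ultimately show "x \<in> U" using s e(5) by simp
  qed
  ultimately show ?thesis by blast
qed

lemma open_cone: "open U"
proof (subst open_subopen, intro ballI)
  fix t assume "t \<in> U"
  then obtain r p where t: "t = r *\<^sub>R p" "r > 0" "p \<in> H" unfolding cone_over_def by blast
  then obtain W where W: "open W" "p \<in> W" "W \<subseteq> U" using cone_neighbourhood by blast
  have "open ((*\<^sub>R) r ` W)" using W t by (intro open_scaling) auto
  moreover have "(*\<^sub>R) r ` W \<subseteq> U" using W t cone_scaleR by auto
  ultimately show "\<exists>T. open T \<and> t \<in> T \<and> T \<subseteq> U" using W t by blast
qed

text \<open>The line \<open>t + s *\<^sub>R x\<close> is projected radially to \<open>H\<close> by
  dividing by the cube root of \<open>h\<close>. The hypothesis makes \<open>h\<close> stationary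
  along the line at \<open>s = 0\<close>, so the projected curve still has velocity
  \<open>x\<close>. Openness of the cone keeps the line in \<open>U\<close> for small
  \<open>s\<close>.\<close>

lemma kernel_imp_tangent:
  assumes "t \<in> H" "k3 k x t t = 0"
  shows "x \<in> tangent_space H t"
proof -
  define \<gamma> where "\<gamma> s = (1 / root 3 (h (t + s *\<^sub>R x))) *\<^sub>R (t + s *\<^sub>R x)" for s :: real
  have ht: "h t = 1" using assms cubic_on_H by auto
  have "\<gamma> 0 = t" by (simp add: \<gamma>_def ht)
  moreover have "\<forall>\<^sub>F s in nhds 0. \<gamma> s \<in> H"
  proof -
    have "open ((\<lambda>s::real. t + s *\<^sub>R x) -` U)"
      by (intro open_vimage open_cone continuous_intros)
    moreover have "0 \<in> (\<lambda>s::real. t + s *\<^sub>R x) -` U" using assms H_subset_cone by simp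
    ultimately have "\<forall>\<^sub>F s in nhds 0. t + s *\<^sub>R x \<in> U"
      using eventually_nhds_in_open by fastforce
    then show ?thesis
    proof (rule eventually_mono)
      fix s assume s: "t + s *\<^sub>R x \<in> U"
      have "h (\<gamma> s) = 1" using h_pos[OF s] by (simp add: \<gamma>_def cubic_scaleR power_one_over)
      then show "\<gamma> s \<in> H"
        using h_pos[OF s] s by (intro in_H_if_cubic_eq_1) (auto simp: \<gamma>_def intro!: cone_scaleR)
    qed
  qed
  moreover have "(\<gamma> has_vector_derivative x) (at 0)"
  proof -
    have "((\<lambda>s::real. t + s *\<^sub>R x) has_derivative (\<lambda>s. s *\<^sub>R x)) (at 0)"
      by (auto intro!: derivative_eq_intros)
    then have "((\<lambda>s. h (t + s *\<^sub>R x)) has_derivative (\<lambda>s. k3 k (s *\<^sub>R x) t t / 2)) (at 0)"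
      by (rule has_derivative_compose) (use cubic_has_derivative[of t] in simp)
    then have "((\<lambda>s. h (t + s *\<^sub>R x)) has_real_derivative 0) (at 0)"
      by (simp add: k3_linear_real assms has_field_derivative_def lambda_zero)
    then have "((\<lambda>s. 1 / root 3 (h (t + s *\<^sub>R x))) has_real_derivative 0) (at 0)"
      by (auto intro!: derivative_eq_intros simp: ht)
    moreover have "((\<lambda>s. t + s *\<^sub>R x) has_vector_derivative x) (at 0)"
      by (auto intro!: derivative_eq_intros)
    ultimately show ?thesis
      using has_vector_derivative_scaleR unfolding \<gamma>_def by (fastforce simp: ht)
  qed
  ultimately show ?thesis unfolding tangent_space_def by blast
qed

text \<open>Nondegeneracy of k(t, -, -): at the rescaled point of \<open>H\<close> a kernel vector
  is tangent, and the Hessian of \<open>h\<close> vanishes on it, against the definiteness in the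
  PSR condition.\<close>

lemma k2_eq_0_imp:
  assumes "t \<in> U" "k2 k t x = 0"
  shows "x = 0"
proof (rule ccontr)
  assume "x \<noteq> 0"
  obtain r s where t: "t = r *\<^sub>R s" "r > 0" "s \<in> H"
    using assms(1) unfolding cone_over_def by blast
  then have "k2 k s x = 0" using assms(2) by (simp add: k2_linear)
  then have "k3 k y s x = 0" for y by (metis inner_k2(1) inner_zero_right)
  then have "k3 k x s s = 0" "k3 k s x x = 0" by (metis k3_commute k3_commute')+
  then show False
    using kernel_imp_tangent[OF t(3)] psr \<open>x \<noteq> 0\<close> t(3) hessian_cubic[of s x x]
    unfolding psr_manifold_def by fastforce
qed

end

section \<open>Coefficients of the metric\<close>

definition tail :: "real ^ ('n::finite option) \<Rightarrow> real ^ 'n" where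
  "tail v = (\<chi> a. v $ Some a)"

lemma tail_component [simp]: "tail v $ a = v $ Some a"
  by (simp add: tail_def)

lemma sum_option: "(\<Sum>i\<in>UNIV. f i) = f None + (\<Sum>a\<in>UNIV. f (Some a))"
  for f :: "'n::finite option \<Rightarrow> 'b::comm_monoid_add"
  by (simp add: UNIV_option_conv sum.reindex)

lemma Re_vec_simps [simp]:
  "Re_vec (x + y) = Re_vec x + Re_vec y" "Im_vec (x + y) = Im_vec x + Im_vec y"
  "Re_vec (axis a c) = axis a (Re c)" "Im_vec (axis a c) = axis a (Im c)"
  "Re_vec x $ i = Re (x $ i)" "Im_vec x $ i = Im (x $ i)"
  by (auto simp: Re_vec_def Im_vec_def vec_eq_iff axis_def)

lemma axis_0 [simp]: "axis a 0 = 0"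
  by (simp add: vec_eq_iff axis_def)

lemma k3_complex:
  "Re (k3 k x y z) = k3 k (Re_vec x) (Re_vec y) (Re_vec z) - k3 k (Re_vec x) (Im_vec y) (Im_vec z)
     - k3 k (Im_vec x) (Re_vec y) (Im_vec z) - k3 k (Im_vec x) (Im_vec y) (Re_vec z)"
  "Im (k3 k x y z) = k3 k (Re_vec x) (Re_vec y) (Im_vec z) + k3 k (Re_vec x) (Im_vec y) (Re_vec z)
     + k3 k (Im_vec x) (Re_vec y) (Re_vec z) - k3 k (Im_vec x) (Im_vec y) (Im_vec z)"
  unfolding k3_def
  by (simp_all add: sum.distrib[symmetric] sum_subtractf[symmetric] algebra_simps)

section \<open>The metric of the tube domain\<close>

context symmetric_cubic
begin

text \<open>This is \<open>G\<^sub>t\<close> of the overview: the first and second derivatives of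
  \<open>h\<close> along \<open>v\<close> are k(t, t, v) / 2 and k(t, v, v).\<close>

abbreviation ln_metric :: "real ^ 'n \<Rightarrow> real ^ 'n \<Rightarrow> real" where
  "ln_metric t v \<equiv> (k3 k t t v)\<^sup>2 / (16 * (h t)\<^sup>2) - k3 k t v v / (4 * h t)"

text \<open>The potential depends on \<open>w\<close> only through \<open>Im_vec w\<close>, so the
  real direction contributes nothing and the imaginary one enters with the factor i/2.\<close>

lemma wirtinger_cnj_kahler_potential:
  assumes "h (Im_vec w) > 0"
  shows "wirtinger_cnj b (\<lambda>w. of_real (kahler_potential k w)) w =
    - \<i> * of_real (k3 k (axis b 1) (Im_vec w) (Im_vec w) / (4 * h (Im_vec w)))"
proof -
  let ?t = "Im_vec w"
  have "((\<lambda>s. - ln (8 * h (?t + axis b s))) has_real_derivative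
      - (k3 k (axis b 1) ?t ?t / (2 * h ?t))) (at 0)"
    by (auto intro!: derivative_eq_intros cubic_axis_has_field_derivative simp: assms)
  then have "((\<lambda>s. complex_of_real (- ln (8 * h (?t + axis b s)))) has_vector_derivative
      of_real (- (k3 k (axis b 1) ?t ?t / (2 * h ?t)))) (at 0)"
    by (rule has_vector_derivative_of_real)
  then show ?thesis
    unfolding wirtinger_cnj_def kahler_potential_def K_fun_def
    by (simp add: vector_derivative_at)
qed

lemma wirtinger_wirtinger_cnj_kahler_potential:
  assumes "h (Im_vec z) > 0"
  shows "wirtinger a (wirtinger_cnj b (\<lambda>w. of_real (kahler_potential k w))) z =
    of_real (k3 k (axis a 1) (Im_vec z) (Im_vec z) * k3 k (axis b 1) (Im_vec z) (Im_vec z)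
        / (16 * (h (Im_vec z))\<^sup>2) - k3 k (axis a 1) (axis b 1) (Im_vec z) / (4 * h (Im_vec z)))"
proof -
  let ?t = "Im_vec z"
  let ?f = "\<lambda>t. - \<i> * complex_of_real (k3 k (axis b 1) t t / (4 * h t))"
  let ?D = "2 * k3 k (axis a 1) (axis b 1) ?t / (4 * h ?t)
      - k3 k (axis b 1) ?t ?t * (k3 k (axis a 1) ?t ?t / 2) / (4 * (h ?t)\<^sup>2)"
  have "((\<lambda>s. k3 k (axis b 1) (?t + axis a s) (?t + axis a s) / (4 * h (?t + axis a s)))
      has_real_derivative ?D) (at 0)"
    using assms
    by (auto intro!: derivative_eq_intros cubic_axis_has_field_derivative
        k3_axis_has_field_derivative simp: power2_eq_square field_simps)
  then have "((\<lambda>s. complex_of_real (k3 k (axis b 1) (?t + axis a s) (?t + axis a s) / (4 * h (?t + axis a s))))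
      has_vector_derivative of_real ?D) (at 0)"
    by (rule has_vector_derivative_of_real)
  then have D: "((\<lambda>s. ?f (?t + axis a s)) has_vector_derivative - \<i> * of_real ?D) (at 0)"
    by (rule has_vector_derivative_mult_right)
  \<comment> \<open>The formula for the inner derivative requires \<open>h > 0\<close>, which
    continuity provides near \<open>s = 0\<close>. This is enough for the outer derivative.\<close>
  have "isCont (\<lambda>s. h (?t + axis a s)) 0"
    by (rule DERIV_isCont[OF cubic_axis_has_field_derivative])
  then have "((\<lambda>s. h (?t + axis a s)) \<longlongrightarrow> h (?t + axis a 0)) (nhds 0)"
    unfolding isCont_def by (rule tendsto_at_iff_tendsto_nhds[where g = "\<lambda>s. h (?t + axis a s)", THEN iffD1])
  then have "\<forall>\<^sub>F s in nhds 0. h (?t + axis a s) > 0"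
    by (rule order_tendstoD(1)) (simp add: assms)
  then have "\<forall>\<^sub>F s in nhds 0. ?f (?t + axis a s) =
      wirtinger_cnj b (\<lambda>w. of_real (kahler_potential k w)) (z + axis a (\<i> * of_real s))"
    by (rule eventually_mono) (simp add: wirtinger_cnj_kahler_potential)
  then have "vector_derivative (\<lambda>s. wirtinger_cnj b (\<lambda>w. of_real (kahler_potential k w))
      (z + axis a (\<i> * of_real s))) (at 0) = vector_derivative (\<lambda>s. ?f (?t + axis a s)) (at 0)"
    by (intro vector_derivative_cong_eq) (auto elim: eventually_mono)
  also have "\<dots> = - \<i> * of_real ?D" by (rule vector_derivative_at[OF D])
  finally have 1: "vector_derivative (\<lambda>s. wirtinger_cnj b (\<lambda>w. of_real (kahler_potential k w))
      (z + axis a (\<i> * of_real s))) (at 0) = - \<i> * of_real ?D" .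
  have 2: "vector_derivative (\<lambda>s. wirtinger_cnj b (\<lambda>w. of_real (kahler_potential k w))
      (z + axis a (of_real s))) (at 0) = 0"
    using assms by (simp add: wirtinger_cnj_kahler_potential)
  have "(0 - \<i> * (- \<i> * complex_of_real ?D)) / 2 = of_real (- ?D / 2)"
    by (simp add: complex_eq_iff)
  also have "- ?D / 2 = k3 k (axis a 1) ?t ?t * k3 k (axis b 1) ?t ?t / (16 * (h ?t)\<^sup>2)
      - k3 k (axis a 1) (axis b 1) ?t / (4 * h ?t)"
    using assms by (simp add: field_simps)
  finally show ?thesis unfolding wirtinger_def 1 2 .
qed

lemma sum_k3_axis: "(\<Sum>a\<in>UNIV. k3 k (axis a 1) y z * x $ a) = k3 k x y (z :: real ^ 'n)"
proof -
  have "k3 k x y z = x \<bullet> k2 k y z" by (simp add: inner_k2)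
  then show ?thesis unfolding k3_axis by (simp add: inner_vec_def mult.commute)
qed

text \<open>The coefficients are real, so only the real part of each product of an entry of
  \<open>u\<close> with a conjugate entry matters, and the form splits over \<open>Re_vec u\<close>
  and \<open>Im_vec u\<close>. Here and below only diagonal values are computed; polarization
  supplies the rest at the end.\<close>

lemma tube_metric_quadratic:
  assumes "h (Im_vec z) > 0"
  shows "tube_metric k z u u = ln_metric (Im_vec z) (Re_vec u) + ln_metric (Im_vec z) (Im_vec u)"
proof -
  let ?t = "Im_vec z" and ?A = "\<lambda>a. axis a 1 :: real ^ 'n"
  define C where "C a b = k3 k (?A a) ?t ?t * k3 k (?A b) ?t ?t / (16 * (h ?t)\<^sup>2)
      - k3 k (?A a) (?A b) ?t / (4 * h ?t)" for a b
  have C: "(\<Sum>a\<in>UNIV. \<Sum>b\<in>UNIV. C a b * (x $ a * x $ b)) = ln_metric ?t x" for x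
  proof -
    have "(\<Sum>a\<in>UNIV. k3 k (?A a) ?t ?t * x $ a) * (\<Sum>b\<in>UNIV. k3 k (?A b) ?t ?t * x $ b) / (16 * (h ?t)\<^sup>2)
        = (\<Sum>a\<in>UNIV. \<Sum>b\<in>UNIV. k3 k (?A a) ?t ?t * k3 k (?A b) ?t ?t / (16 * (h ?t)\<^sup>2) * (x $ a * x $ b))"
      unfolding sum_product sum_divide_distrib by (simp add: mult_ac)
    moreover have "(\<Sum>a\<in>UNIV. (\<Sum>b\<in>UNIV. k3 k (?A b) (?A a) ?t * x $ b) * x $ a) / (4 * h ?t)
        = (\<Sum>a\<in>UNIV. \<Sum>b\<in>UNIV. k3 k (?A a) (?A b) ?t / (4 * h ?t) * (x $ a * x $ b))"
      unfolding sum_distrib_right sum_divide_distrib by (simp add: k3_ac mult_ac)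
    moreover have "(\<Sum>a\<in>UNIV. (\<Sum>b\<in>UNIV. k3 k (?A b) (?A a) ?t * x $ b) * x $ a) = k3 k ?t x x"
    proof -
      have "k3 k x (?A a) ?t = k3 k (?A a) x ?t" for a by (rule k3_commute)
      then show ?thesis by (simp only: sum_k3_axis k3_left_commute[of x x ?t])
    qed
    ultimately show ?thesis
      unfolding C_def left_diff_distrib sum_subtractf sum_k3_axis by (simp add: k3_ac power2_eq_square)
  qed
  have "tube_metric k z u u = (\<Sum>a\<in>UNIV. \<Sum>b\<in>UNIV. C a b * (Re_vec u $ a * Re_vec u $ b)
      + C a b * (Im_vec u $ a * Im_vec u $ b))"
    unfolding tube_metric_def wirtinger_wirtinger_cnj_kahler_potential[OF assms] C_def[symmetric] sym_prod_def
    by (simp add: algebra_simps)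
  then show ?thesis unfolding sum.distrib C .
qed

section \<open>The period matrix, the matrix \<open>N\<close> and the forms \<open>W\<close>\<close>

lemma partial_deriv_prepotential:
  assumes "X $ None \<noteq> 0"
  shows "partial_deriv None (prepotential k) X = cubic k (\<chi> a. X $ Some a) / (X $ None)\<^sup>2"
    "partial_deriv (Some b) (prepotential k) X =
      - k3 k (axis b 1) (\<chi> a. X $ Some a) (\<chi> a. X $ Some a) / (2 * X $ None)"
proof -
  let ?Y = "\<chi> a. X $ Some a"
  have "(\<chi> a. (X + axis None s) $ Some a) = ?Y" for s by (simp add: vec_eq_iff axis_def)
  then have eq: "prepotential k (X + axis None s) = - cubic k ?Y / (X $ None + s)" for s
    unfolding prepotential_def by (simp add: axis_def)
  show "partial_deriv None (prepotential k) X = cubic k ?Y / (X $ None)\<^sup>2"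
    unfolding partial_deriv_def eq
    by (rule DERIV_imp_deriv) (use assms in \<open>auto intro!: derivative_eq_intros simp: power2_eq_square\<close>)
  have "(\<chi> a. (X + axis (Some b) s) $ Some a) = ?Y + axis b s" for s
    by (simp add: vec_eq_iff axis_def)
  then have eq: "prepotential k (X + axis (Some b) s) = - cubic k (?Y + axis b s) / X $ None" for s
    unfolding prepotential_def by (simp add: axis_def)
  show "partial_deriv (Some b) (prepotential k) X = - k3 k (axis b 1) ?Y ?Y / (2 * X $ None)"
    unfolding partial_deriv_def eq
    by (rule DERIV_imp_deriv)
      (use assms in \<open>auto intro!: derivative_eq_intros cubic_axis_has_field_derivative\<close>)
qed

lemma period_matrix:
  "period_matrix k z $ None $ None = - 2 * cubic k z"
  "period_matrix k z $ Some a $ None = k3 k (axis a 1) z z / 2"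
  "period_matrix k z $ None $ Some b = k3 k (axis b 1) z z / 2"
  "period_matrix k z $ Some a $ Some b = - k3 k (axis a 1) (axis b 1) z"
proof -
  \<comment> \<open>The first partial derivatives are known where the coordinate \<open>None\<close>
    is nonzero. A shift along the axis \<open>None\<close> turns that coordinate into
    \<open>1 + s\<close>, so the closed formula may be differentiated on the open set of all
    \<open>s\<close> other than -1.\<close>
  have *: "deriv (\<lambda>s. partial_deriv j (prepotential k) (homog z + axis i s)) 0 = D"
    if "(f has_field_derivative D) (at 0)"
      "\<And>s. (homog z + axis i s) $ None \<noteq> 0 \<Longrightarrow> partial_deriv j (prepotential k) (homog z + axis i s) = f s"
    for i j f D
  proof -
    have "\<forall>\<^sub>F s :: complex in nhds 0. s \<in> - {-1}" by (rule eventually_nhds_in_open) auto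
    then have "\<forall>\<^sub>F s in nhds 0. partial_deriv j (prepotential k) (homog z + axis i s) = f s"
      by (rule eventually_mono)
        (intro that(2), auto simp: axis_def homog_def add_eq_0_iff)
    from DERIV_cong_ev[OF refl this refl] that(1) show ?thesis by (simp add: DERIV_imp_deriv)
  qed
  have N: "(\<chi> a. (homog z + axis None s) $ Some a) = z" "(homog z + axis None s) $ None = 1 + s" for s
    by (simp_all add: vec_eq_iff axis_def homog_def)
  have S: "(\<chi> a. (homog z + axis (Some b) s) $ Some a) = z + axis b s"
      "(homog z + axis (Some b) s) $ None = 1" for s b
    by (simp_all add: vec_eq_iff axis_def homog_def)
  have "((\<lambda>s. cubic k z / (1 + s)\<^sup>2) has_field_derivative - 2 * cubic k z) (at 0)"
    by (auto intro!: derivative_eq_intros)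
  then show "period_matrix k z $ None $ None = - 2 * cubic k z"
    unfolding period_matrix_def vec_lambda_beta unfolding partial_deriv_def[of None "partial_deriv _ _"]
    by (rule *) (simp only: partial_deriv_prepotential N simp_thms)
  have "((\<lambda>s. - k3 k (axis b 1) z z / (2 * (1 + s))) has_field_derivative k3 k (axis b 1) z z / 2) (at 0)"
    by (auto intro!: derivative_eq_intros)
  then show "period_matrix k z $ None $ Some b = k3 k (axis b 1) z z / 2"
    unfolding period_matrix_def vec_lambda_beta unfolding partial_deriv_def[of None "partial_deriv _ _"]
    by (rule *) (simp only: partial_deriv_prepotential N simp_thms)
  show "period_matrix k z $ Some a $ None = k3 k (axis a 1) z z / 2"
    unfolding period_matrix_def vec_lambda_beta unfolding partial_deriv_def[of "Some a" "partial_deriv _ _"]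
    by (rule *[OF cubic_axis_has_field_derivative]) (simp only: partial_deriv_prepotential S simp_thms, simp)
  show "period_matrix k z $ Some a $ Some b = - k3 k (axis a 1) (axis b 1) z"
    unfolding period_matrix_def vec_lambda_beta unfolding partial_deriv_def[of "Some a" "partial_deriv _ _"]
    by (rule *[where f = "\<lambda>s. - (k3 k (axis b 1) (z + axis a s) (z + axis a s) / 2)"])
      (auto intro!: derivative_eq_intros k3_axis_has_field_derivative simp: partial_deriv_prepotential S simp del: vector_add_component)
qed

text \<open>In terms of \<open>Y\<close> the matrix decouples: adding the inner product of
  \<open>b\<close> with the other entries to the entry \<open>None\<close> leaves
  \<open>- 4 * h t * X $ None\<close>.\<close>

lemma N_matrix_mult:
  fixes z X
  defines "b \<equiv> Re_vec z" and "t \<equiv> Im_vec z"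
  defines "Y \<equiv> tail X - X $ None *\<^sub>R b"
  shows "(N_matrix k z *v X) $ Some a = 2 * k2 k t Y $ a"
    "(N_matrix k z *v X) $ None = - 2 * k3 k b t Y - 4 * h t * X $ None"
proof -
  have N: "N_matrix k z $ Some a $ Some c = 2 * k3 k (axis a 1) (axis c 1) t"
    "N_matrix k z $ Some a $ None = - 2 * k3 k (axis a 1) b t"
    "N_matrix k z $ None $ Some c = - 2 * k3 k (axis c 1) b t"
    "N_matrix k z $ None $ None = 2 * k3 k b b t - 4 * h t" for a c
    unfolding N_matrix_def b_def t_def
    by (simp_all add: period_matrix k3_complex cubic_eq_k3 k3_linear_real k3_ac)
  have "(\<Sum>c\<in>UNIV. k3 k (axis a 1) (axis c 1) t * X $ Some c) = k3 k (axis a 1) (tail X) t"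
    using sum_k3_axis[of "axis a 1" t "tail X"] by (simp add: k3_ac)
  then show "(N_matrix k z *v X) $ Some a = 2 * k2 k t Y $ a"
    unfolding matrix_vector_mult_def vec_lambda_beta sum_option N Y_def k3_axis[symmetric] mult.assoc
      sum_distrib_left[symmetric]
    by (simp add: k3_linear k3_linear_real k3_ac algebra_simps)
  have "(\<Sum>c\<in>UNIV. k3 k (axis c 1) b t * X $ Some c) = k3 k (tail X) b t"
    using sum_k3_axis[of b t "tail X"] by (simp add: k3_ac)
  then show "(N_matrix k z *v X) $ None = - 2 * k3 k b t Y - 4 * h t * X $ None"
    unfolding matrix_vector_mult_def vec_lambda_beta sum_option N Y_def mult.assoc
      sum_distrib_left[symmetric]
    by (simp add: k3_linear k3_linear_real k3_ac algebra_simps)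
qed

text \<open>The inverse of \<open>N\<close> is real, so its contraction with \<open>W\<close> and
  the conjugate of \<open>W\<close> has as real part the sum of one quadratic form evaluated at
  \<open>re_W\<close> and at \<open>im_W\<close>.\<close>

abbreviation re_W :: "complex ^ 'n \<Rightarrow> 'n IIA \<Rightarrow> real ^ 'n option" where
  "re_W z w \<equiv> (\<chi> i. Re (W_form k z i w))"

abbreviation im_W :: "complex ^ 'n \<Rightarrow> 'n IIA \<Rightarrow> real ^ 'n option" where
  "im_W z w \<equiv> (\<chi> i. Im (W_form k z i w))"

lemma W_form_components:
  fixes z :: "complex ^ 'n"
  defines "b \<equiv> Re_vec z" and "t \<equiv> Im_vec z"
  assumes w: "w = (dz, d\<rho>, d\<zeta>', d\<zeta>, d\<sigma>)"
  shows "tail (re_W z w) = tail d\<zeta>' - (d\<zeta> $ None / 2) *\<^sub>R (k2 k b b - k2 k t t) + k2 k b (tail d\<zeta>)"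
    "tail (im_W z w) = k2 k t (tail d\<zeta>) - d\<zeta> $ None *\<^sub>R k2 k b t"
    "re_W z w $ None = d\<zeta>' $ None + d\<zeta> $ None * (h b - k3 k b t t / 2) * 2
      - (k3 k b b (tail d\<zeta>) - k3 k t t (tail d\<zeta>)) / 2"
    "im_W z w $ None = d\<zeta> $ None * (k3 k b b t / 2 - h t) * 2 - k3 k b t (tail d\<zeta>)"
proof -
  have *: "(\<Sum>a\<in>UNIV. k3 k (axis a 1) x y * d\<zeta> $ Some a) = k3 k (tail d\<zeta>) x y" for x y :: "real ^ 'n"
    using sum_k3_axis[of x y "tail d\<zeta>"] by simp
  have **: "(\<Sum>c\<in>UNIV. k3 k (axis a 1) (axis c 1) x * d\<zeta> $ Some c) = k2 k x (tail d\<zeta>) $ a"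
    for x :: "real ^ 'n" and a
    using *[of "axis a 1" x] unfolding k3_axis[symmetric] by (simp add: k3_ac)
  show "tail (re_W z w) = tail d\<zeta>' - (d\<zeta> $ None / 2) *\<^sub>R (k2 k b b - k2 k t t) + k2 k b (tail d\<zeta>)"
    unfolding vec_eq_iff
    by (simp add: w W_form_def sum_option period_matrix k3_complex k3_linear_real b_def t_def sum_negf
        ** flip: k3_axis)
  show "tail (im_W z w) = k2 k t (tail d\<zeta>) - d\<zeta> $ None *\<^sub>R k2 k b t"
    unfolding vec_eq_iff
    by (simp add: w W_form_def sum_option period_matrix k3_complex k3_linear_real b_def t_def sum_negf
        ** flip: k3_axis) (simp add: k3_axis k2_commute[of "Im_vec z" "Re_vec z"] algebra_simps)
  show "re_W z w $ None = d\<zeta>' $ None + d\<zeta> $ None * (h b - k3 k b t t / 2) * 2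
      - (k3 k b b (tail d\<zeta>) - k3 k t t (tail d\<zeta>)) / 2"
    by (simp add: w W_form_def sum_option period_matrix k3_complex k3_linear_real b_def t_def cubic_eq_k3
        left_diff_distrib sum_subtractf * flip: sum_divide_distrib)
      (simp add: k3_ac field_simps)
  show "im_W z w $ None = d\<zeta> $ None * (k3 k b b t / 2 - h t) * 2 - k3 k b t (tail d\<zeta>)"
    by (simp add: w W_form_def sum_option period_matrix k3_complex k3_linear_real b_def t_def cubic_eq_k3
        distrib_right sum.distrib * flip: sum_divide_distrib)
      (simp add: k3_ac field_simps)
qed

end

section \<open>The inverse of \<open>N\<close> and the quadratic form of the q-map metric\<close>

context psr
begin

text \<open>The inverse of k(t, -, -), from covectors to vectors; \<open>bij_k2\<close> makes it a
  genuine inverse when \<open>t\<close> lies in the cone.\<close>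

definition k2_inv :: "real ^ 'n \<Rightarrow> real ^ 'n \<Rightarrow> real ^ 'n" where
  "k2_inv t = inv_into UNIV (k2 k t)"

lemma linear_k2: "linear (k2 k t)"
  by (auto intro!: linearI simp: k2_linear)

lemma bij_k2:
  assumes "t \<in> U"
  shows "bij (k2 k t)"
proof -
  have "inj (k2 k t)"
    using linear_injective_0[OF linear_k2] k2_eq_0_imp[OF assms] by blast
  then show ?thesis using linear_injective_imp_surjective[OF linear_k2] by (simp add: bij_def)
qed

lemma k2_inv:
  assumes "t \<in> U"
  shows "k2 k t (k2_inv t P) = P" "k2_inv t (k2 k t x) = x"
  using bij_k2[OF assms] by (simp_all add: k2_inv_def bij_def surj_f_inv_f)

lemma linear_k2_inv:
  assumes "t \<in> U"
  shows "linear (k2_inv t)"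
  by (rule linearI) (metis k2_inv[OF assms] k2_linear(2), metis k2_inv[OF assms] k2_linear(6))

text \<open>For a kernel vector, nondegeneracy of k(t, -, -) gives \<open>Y = 0\<close>, and then
  positivity of \<open>h\<close> gives \<open>X $ None = 0\<close>. So \<open>N\<close> is
  invertible.\<close>

lemma matrix_inv_N_matrix:
  assumes "Im_vec z \<in> U"
  shows "matrix_inv (N_matrix k z) *v (N_matrix k z *v X) = X"
proof -
  let ?t = "Im_vec z"
  have "X = 0" if "N_matrix k z *v X = 0" for X
  proof -
    define Y where "Y = tail X - X $ None *\<^sub>R Re_vec z"
    have "2 * k2 k ?t Y $ a = 0" for a
      unfolding Y_def N_matrix_mult(1)[symmetric] that by simp
    then have "Y = 0" using k2_eq_0_imp[OF assms, of Y] by (simp add: vec_eq_iff)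
    moreover have "- 2 * k3 k (Re_vec z) ?t Y - 4 * h ?t * X $ None = 0"
      unfolding Y_def N_matrix_mult(2)[symmetric] that by simp
    ultimately have "X $ None = 0" using h_pos[OF assms] by (simp add: k3_linear_real)
    moreover then have "tail X = 0" using \<open>Y = 0\<close> by (simp add: Y_def)
    then have "X $ Some a = 0" for a by (metis tail_component zero_index)
    ultimately show "X = 0" by (metis (mono_tags) not_None_eq vec_eq_iff zero_index)
  qed
  then obtain B where "B ** N_matrix k z = mat 1"
    using matrix_left_invertible_ker by blast
  then have "invertible (N_matrix k z)" using invertible_left_inverse by blast
  then have "matrix_inv (N_matrix k z) ** N_matrix k z = mat 1"
    unfolding invertible_def matrix_inv_def by (rule someI2_ex) simp
  then show ?thesis by (simp add: matrix_vector_mul_assoc)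
qed

text \<open>The system \<open>N_matrix k z *v X = P\<close> is solved explicitly:
  \<open>P $ None + b \<bullet> tail P\<close> determines \<open>X $ None\<close>, and
  \<open>tail P\<close> determines the shifted vector as half of
  \<open>k2_inv t (tail P)\<close>.\<close>

lemma N_inverse_quadratic:
  fixes z P
  defines "b \<equiv> Re_vec z" and "t \<equiv> Im_vec z"
  assumes t: "t \<in> U"
  shows "P \<bullet> (matrix_inv (N_matrix k z) *v P) =
    (tail P \<bullet> k2_inv t (tail P)) / 2 - (P $ None + b \<bullet> tail P)\<^sup>2 / (4 * h t)"
proof -
  define y where "y = k2_inv t (tail P)"
  have y: "k2 k t y = tail P" by (simp add: y_def k2_inv[OF t])
  define x0 where "x0 = - (P $ None + b \<bullet> tail P) / (4 * h t)"
  define X :: "real ^ 'n option" where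
    "X = (\<chi> i. case i of None \<Rightarrow> x0 | Some a \<Rightarrow> y $ a / 2 + x0 * b $ a)"
  have tX: "tail X = y /\<^sub>R 2 + x0 *\<^sub>R b" by (simp add: vec_eq_iff X_def)
  have X0: "X $ None = x0" by (simp add: X_def)
  have Y: "tail X - X $ None *\<^sub>R b = y /\<^sub>R 2" by (simp add: tX X0)
  have "N_matrix k z *v X = P"
  proof -
    have "(N_matrix k z *v X) $ i = P $ i" for i
    proof (cases i)
      case None
      have "k3 k b t y = b \<bullet> tail P" by (simp add: y flip: inner_k2)
      then show ?thesis
        using N_matrix_mult(2)[of z X, folded b_def t_def, unfolded Y] h_pos[OF t] None
        by (simp add: X0 x0_def k3_linear_real)
    next
      case (Some a)
      then show ?thesis
        using N_matrix_mult(1)[of z X a, folded b_def t_def, unfolded Y]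
        by (simp add: k2_linear y)
    qed
    then show ?thesis by (simp add: vec_eq_iff)
  qed
  then have "matrix_inv (N_matrix k z) *v P = X"
    using matrix_inv_N_matrix[of z X] t by (simp add: t_def)
  moreover have "P \<bullet> X = P $ None * x0 + tail P \<bullet> tail X"
    by (simp add: inner_vec_def sum_option X0)
  then have "P \<bullet> X = (tail P \<bullet> y) / 2 + x0 * (P $ None + b \<bullet> tail P)"
    by (simp add: tX inner_add_right inner_commute[of b] algebra_simps)
  ultimately show ?thesis
    by (simp add: y_def x0_def power2_eq_square del: minus_add_distrib)
qed

text \<open>\<open>A\<close> and \<open>B\<close> are the real and imaginary parts of W_0 + b^a W_a,
  the combination occurring in \<open>N_inverse_quadratic\<close>. The contraction z^i W_i has real
  part \<open>A - t \<bullet> R\<close> and imaginary part \<open>B + t \<bullet> P\<close>. As 2/K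
  = 1/(4h), its squared modulus has the same prefactor as the squares of \<open>A\<close> and
  \<open>B\<close>.\<close>

lemma qmap_metric_quadratic:
  fixes z w
  defines "b \<equiv> Re_vec z" and "t \<equiv> Im_vec z"
  defines "P \<equiv> tail (re_W z w)" and "R \<equiv> tail (im_W z w)"
  defines "A \<equiv> re_W z w $ None + b \<bullet> P" and "B \<equiv> im_W z w $ None + b \<bullet> R"
  assumes t: "t \<in> U"
  shows "qmap_metric k (z, \<rho>, \<zeta>', \<zeta>, \<sigma>) w w =
    ln_metric t (Re_vec (fst w)) + ln_metric t (Im_vec (fst w)) + (fst (snd w))\<^sup>2 / (4 * \<rho>\<^sup>2)
    - ((P \<bullet> k2_inv t P + R \<bullet> k2_inv t R) / 2
        - (A\<^sup>2 + B\<^sup>2 + (A - t \<bullet> R)\<^sup>2 + (B + t \<bullet> P)\<^sup>2) / (4 * h t)) / (4 * \<rho>)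
    + (sigma_form (z, \<rho>, \<zeta>', \<zeta>, \<sigma>) w)\<^sup>2 / (64 * \<rho>\<^sup>2)"
proof -
  let ?N = "matrix_inv (N_matrix k z)" and ?W = "\<lambda>i. W_form k z i w" and ?Z = "homog z"
  let ?c = "2 / (8 * h t)" and ?S = "\<Sum>i\<in>UNIV. homog z $ i * W_form k z i w"
  have quad: "(\<Sum>i\<in>UNIV. \<Sum>j\<in>UNIV. ?N $ i $ j * (x $ i * x $ j)) = x \<bullet> (?N *v x)" for x
    by (simp add: inner_vec_def matrix_vector_mult_def sum_distrib_left mult_ac)
  have e1: "(\<Sum>i\<in>UNIV. \<Sum>j\<in>UNIV. (of_real (?N $ i $ j) - of_real ?c * ?Z $ i * cnj (?Z $ j)) * (?W i * cnj (?W j)))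
     = (\<Sum>i\<in>UNIV. \<Sum>j\<in>UNIV. of_real (?N $ i $ j) * (?W i * cnj (?W j))) - of_real ?c * (?S * cnj ?S)"
    unfolding cnj_sum sum_product unfolding sum_distrib_left left_diff_distrib sum_subtractf
    by (simp add: mult_ac)
  have e2: "Re (\<Sum>i\<in>UNIV. \<Sum>j\<in>UNIV. of_real (?N $ i $ j) * (?W i * cnj (?W j)))
      = re_W z w \<bullet> (?N *v re_W z w) + im_W z w \<bullet> (?N *v im_W z w)"
    unfolding quad[symmetric] sum.distrib[symmetric] by (simp add: algebra_simps)
  have e3: "Re (of_real ?c * (?S * cnj ?S)) = ?c * ((A - t \<bullet> R)\<^sup>2 + (B + t \<bullet> P)\<^sup>2)"
  proof -
    have "Re ?S = A - t \<bullet> R" "Im ?S = B + t \<bullet> P"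
      by (simp_all add: A_def B_def P_def R_def b_def t_def sum_option homog_def inner_vec_def
          sum.distrib sum_subtractf)
    moreover have "Re (of_real c * (S * cnj S)) = c * ((Re S)\<^sup>2 + (Im S)\<^sup>2)" for c S
      by (simp add: power2_eq_square)
    ultimately show ?thesis by (simp only:)
  qed
  have e4: "re_W z w \<bullet> (?N *v re_W z w) = (P \<bullet> k2_inv t P) / 2 - A\<^sup>2 / (4 * h t)"
    "im_W z w \<bullet> (?N *v im_W z w) = (R \<bullet> k2_inv t R) / 2 - B\<^sup>2 / (4 * h t)"
    using t unfolding t_def by (simp_all add: N_inverse_quadratic A_def B_def P_def R_def b_def)
  define T where "T = Re (\<Sum>i\<in>UNIV. \<Sum>j\<in>UNIV.
      (of_real (?N $ i $ j) - of_real ?c * ?Z $ i * cnj (?Z $ j)) * (?W i * cnj (?W j)))"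
  have T: "T = (P \<bullet> k2_inv t P + R \<bullet> k2_inv t R) / 2
        - (A\<^sup>2 + B\<^sup>2 + (A - t \<bullet> R)\<^sup>2 + (B + t \<bullet> P)\<^sup>2) / (4 * h t)"
  proof -
    \<comment> \<open>The identity also holds at \<open>H = 0\<close>, where all quotients by
      multiples of \<open>H\<close> are zero.\<close>
    have "p / 2 - a / (4 * H) + (q / 2 - b / (4 * H)) - 2 / (8 * H) * (x + y)
        = (p + q) / 2 - (a + b + x + y) / (4 * H)" for p q a b x y H :: real
      by (cases "H = 0") (simp_all add: field_simps)
    then show ?thesis unfolding T_def e1 minus_complex.sel e2 e3 e4 .
  qed
  have W: "sym_prod (W_form k z i) (\<lambda>w. cnj (W_form k z j w)) w w = ?W i * cnj (?W j)" for i j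
    by (simp add: sym_prod_def)
  have "qmap_metric k (z, \<rho>, \<zeta>', \<zeta>, \<sigma>) w w = tube_metric k z (fst w) (fst w)
      + (fst (snd w))\<^sup>2 / (4 * \<rho>\<^sup>2) - T / (4 * \<rho>)
      + (sigma_form (z, \<rho>, \<zeta>', \<zeta>, \<sigma>) w)\<^sup>2 / (64 * \<rho>\<^sup>2)"
    unfolding qmap_metric_def Let_def fst_conv snd_conv K_fun_def W t_def[symmetric] T_def[symmetric]
    by (simp add: power2_eq_square)
  moreover have "tube_metric k z (fst w) (fst w) = ln_metric t (Re_vec (fst w)) + ln_metric t (Im_vec (fst w))"
    using h_pos[OF t] unfolding t_def by (rule tube_metric_quadratic)
  ultimately show ?thesis unfolding T by (simp only:)
qed

end

section \<open>The metric in type IIB coordinates\<close>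

definition cons_vec :: "real \<Rightarrow> real ^ 'n \<Rightarrow> real ^ ('n::finite option)" where
  "cons_vec x0 x = (\<chi> i. case i of None \<Rightarrow> x0 | Some a \<Rightarrow> x $ a)"

lemma cons_vec_simps [simp]: "cons_vec x0 x $ None = x0" "tail (cons_vec x0 x) = x"
  by (simp_all add: cons_vec_def vec_eq_iff)

lemma inner_option: "v \<bullet> w = v $ None * w $ None + tail v \<bullet> tail w"
  for v w :: "real ^ ('n::finite option)"
  by (simp add: inner_vec_def sum_option)

lemma sigma_form_inner:
  "sigma_form (z, \<rho>, \<zeta>', \<zeta>, \<sigma>) (dz, d\<rho>, d\<zeta>', d\<zeta>, d\<sigma>) = d\<sigma> + \<zeta>' \<bullet> d\<zeta> - \<zeta> \<bullet> d\<zeta>'"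
  by (simp add: sigma_form_def inner_vec_def)

lemma bounded_linear_Re_vec: "bounded_linear Re_vec"
  and bounded_linear_Im_vec: "bounded_linear Im_vec"
  unfolding linear_conv_bounded_linear[symmetric]
  by (auto intro!: linearI simp: vec_eq_iff)

lemma bounded_linear_cons_vec: "bounded_linear (\<lambda>p. cons_vec (fst p) (snd p))"
  unfolding linear_conv_bounded_linear[symmetric]
  by (auto intro!: linearI simp: vec_eq_iff cons_vec_def split: option.split)

lemmas has_derivative_Re_vec [derivative_intros] = bounded_linear.has_derivative[OF bounded_linear_Re_vec]
lemmas has_derivative_Im_vec [derivative_intros] = bounded_linear.has_derivative[OF bounded_linear_Im_vec]

lemma has_derivative_cons_vec [derivative_intros]:
  assumes "(f has_derivative f') (at x within S)" "(g has_derivative g') (at x within S)"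
  shows "((\<lambda>x. cons_vec (f x) (g x)) has_derivative (\<lambda>v. cons_vec (f' v) (g' v))) (at x within S)"
  using bounded_linear.has_derivative[OF bounded_linear_cons_vec has_derivative_Pair[OF assms]] by simp

lemma IIA_of_IIB_eq:
  "IIA_of_IIB k (z, \<tau>, cu, cl, c0, \<psi>) =
    (let b = Re_vec z; x = cu - Re \<tau> *\<^sub>R b
     in (z, (Im \<tau>)\<^sup>2 / 2 * cubic k (Im_vec z),
         cons_vec (c0 - k3 k b b x / 6) (cl + k2 k b x /\<^sub>R 2),
         cons_vec (Re \<tau>) (- x),
         - 2 * \<psi> - Re \<tau> * c0 + cl \<bullet> x - k3 k b cu x / 6))"
  unfolding IIA_of_IIB_def Let_def k3_def k2_def cons_vec_def inner_vec_def
  by (auto simp: vec_eq_iff sum_divide_distrib sum_distrib_left mult_ac split: option.split)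

text \<open>The terms of the product rule are kept apart, since symmetry of \<open>k\<close> becomes
  available only inside the locale.\<close>

definition IIA_of_IIB_deriv ::
  "('n::finite \<Rightarrow> 'n \<Rightarrow> 'n \<Rightarrow> real) \<Rightarrow> 'n IIB \<Rightarrow> 'n IIB \<Rightarrow> 'n IIA" where
  "IIA_of_IIB_deriv k = (\<lambda>(z, \<tau>, cu, cl, c0, \<psi>) (dz, d\<tau>, dcu, dcl, dc0, d\<psi>).
     let b = Re_vec z; t = Im_vec z; x = cu - Re \<tau> *\<^sub>R b; db = Re_vec dz; dt = Im_vec dz;
         dx = dcu - Re d\<tau> *\<^sub>R b - Re \<tau> *\<^sub>R db
     in (dz,
         Im \<tau> * Im d\<tau> * cubic k t
           + (Im \<tau>)\<^sup>2 / 12 * (k3 k dt t t + k3 k t dt t + k3 k t t dt),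
         cons_vec (dc0 - (k3 k db b x + k3 k b db x + k3 k b b dx) / 6)
           (dcl + (k2 k db x + k2 k b dx) /\<^sub>R 2),
         cons_vec (Re d\<tau>) (- dx),
         - 2 * d\<psi> - Re d\<tau> * c0 - Re \<tau> * dc0 + dcl \<bullet> x + cl \<bullet> dx
           - (k3 k db cu x + k3 k b dcu x + k3 k b cu dx) / 6))"

lemma IIA_of_IIB_has_derivative:
  "(IIA_of_IIB k has_derivative IIA_of_IIB_deriv k p) (at p)"
proof -
  have eq: "IIA_of_IIB k = (\<lambda>p. (fst p, (Im (fst (snd p)))\<^sup>2 / 2 * (k3 k (Im_vec (fst p)) (Im_vec (fst p)) (Im_vec (fst p)) / 6),
         cons_vec (fst (snd (snd (snd (snd p)))) - k3 k (Re_vec (fst p)) (Re_vec (fst p))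
              (fst (snd (snd p)) - Re (fst (snd p)) *\<^sub>R Re_vec (fst p)) / 6)
           (fst (snd (snd (snd p))) + k2 k (Re_vec (fst p))
              (fst (snd (snd p)) - Re (fst (snd p)) *\<^sub>R Re_vec (fst p)) /\<^sub>R 2),
         cons_vec (Re (fst (snd p))) (- (fst (snd (snd p)) - Re (fst (snd p)) *\<^sub>R Re_vec (fst p))),
         - 2 * snd (snd (snd (snd (snd p)))) - Re (fst (snd p)) * fst (snd (snd (snd (snd p))))
           + fst (snd (snd (snd p))) \<bullet> (fst (snd (snd p)) - Re (fst (snd p)) *\<^sub>R Re_vec (fst p))
           - k3 k (Re_vec (fst p)) (fst (snd (snd p)))
              (fst (snd (snd p)) - Re (fst (snd p)) *\<^sub>R Re_vec (fst p)) / 6))"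
    by (rule ext) (clarsimp simp: IIA_of_IIB_eq Let_def cubic_eq_k3)
  show ?thesis
    unfolding eq
    by (rule has_derivative_eq_rhs, (rule derivative_intros zero_neq_numeral[symmetric])+)
      (clarsimp simp: fun_eq_iff IIA_of_IIB_deriv_def Let_def cubic_eq_k3 split: prod.split,
        simp add: algebra_simps)
qed

context psr
begin

text \<open>The metric in type IIB coordinates, in terms of one-forms on which \<open>SL(2, \<real>)\<close> acts
  linearly: \<open>\<nu>\<close> is a multiple of the differential of \<open>\<tau>\<^sub>2\<^sup>1\<^sup>/\<^sup>2 t\<close>, \<open>\<omega>\<close> is invariant,
  and \<open>(dcu, db)\<close> and \<open>(\<alpha>, \<beta>)\<close> are doublets.\<close>

definition IIB_form :: "real ^ 'n \<Rightarrow> complex \<Rightarrow> real ^ 'n \<Rightarrow> complex \<Rightarrow> real ^ 'n \<Rightarrow> real ^ 'n \<Rightarrow>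
    real ^ 'n \<Rightarrow> real \<Rightarrow> real \<Rightarrow> real" where
  "IIB_form t \<tau> \<nu> d\<tau> db dcu \<omega> \<alpha> \<beta> =
     (k3 k t t \<nu>)\<^sup>2 / (8 * (h t)\<^sup>2) - k3 k t \<nu> \<nu> / (4 * h t)
     + (cmod d\<tau>)\<^sup>2 / (4 * (Im \<tau>)\<^sup>2)
     + (ln_metric t (dcu - Re \<tau> *\<^sub>R db) / (Im \<tau>)\<^sup>2 + ln_metric t db)
     - (\<omega> \<bullet> k2_inv t \<omega> - (t \<bullet> \<omega>)\<^sup>2 / (2 * h t)) / (4 * (Im \<tau>)\<^sup>2 * h t)
     + ((Im \<tau>)\<^sup>2 * \<alpha>\<^sup>2 + (\<beta> + Re \<tau> * \<alpha>)\<^sup>2) / (4 * (Im \<tau>) ^ 4 * (h t)\<^sup>2)"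

text \<open>\<open>\<kappa>\<close> is the antisymmetric pairing, through \<open>k\<close>, of the
  doublets (cu, b) and (dcu, db); a matrix acting on both multiplies it by its determinant.\<close>

definition IIB_metric :: "'n IIB \<Rightarrow> 'n IIB \<Rightarrow> real" where
  "IIB_metric = (\<lambda>(z, \<tau>, cu, cl, c0, \<psi>) (dz, d\<tau>, dcu, dcl, dc0, d\<psi>).
     let b = Re_vec z; t = Im_vec z; db = Re_vec dz; dt = Im_vec dz; \<kappa> = k2 k cu db - k2 k b dcu
     in IIB_form t \<tau> (dt + (Im d\<tau> / (2 * Im \<tau>)) *\<^sub>R t) d\<tau> db dcu
       (dcl + \<kappa> /\<^sub>R 2) (dc0 + b \<bullet> (dcl + \<kappa> /\<^sub>R 6)) (d\<psi> - cu \<bullet> (dcl + \<kappa> /\<^sub>R 6)))"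

text \<open>The quadratic form is pulled back along the coordinate change. The substance lies in the
  facts \<open>P\<close>, \<open>R\<close>, \<open>A\<close>, \<open>B\<close> and \<open>S\<close>:
  there all dependence on \<open>b\<close>, \<open>cu\<close>, \<open>cl\<close>, \<open>c0\<close>
  and \<open>\<psi>\<close> is absorbed into \<open>\<omega>\<close>, \<open>\<eta>\<close>,
  \<open>\<alpha>\<close> and \<open>\<beta>\<close>.\<close>

lemma qmap_metric_IIB:
  assumes "p \<in> IIB_domain H"
  shows "qmap_metric k (IIA_of_IIB k p) (IIA_of_IIB_deriv k p w) (IIA_of_IIB_deriv k p w) = IIB_metric p w"
proof -
  obtain z \<tau> cu cl c0 \<psi> where p_def: "p = (z, \<tau>, cu, cl, c0, \<psi>)" by (cases p)
  obtain dz d\<tau> dcu dcl dc0 d\<psi> where w_def: "w = (dz, d\<tau>, dcu, dcl, dc0, d\<psi>)" by (cases w)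
  define b where "b = Re_vec z"
  define t where "t = Im_vec z"
  define db where "db = Re_vec dz"
  define dt where "dt = Im_vec dz"
  define \<kappa> where "\<kappa> = k2 k cu db - k2 k b dcu"
  have t: "t \<in> U" and \<tau>: "Im \<tau> > 0"
    using assms unfolding p_def t_def IIB_domain_def tube_domain_def by auto
  let ?\<nu> = "dt + (Im d\<tau> / (2 * Im \<tau>)) *\<^sub>R t" and ?\<omega> = "dcl + \<kappa> /\<^sub>R 2"
  let ?\<alpha> = "dc0 + b \<bullet> (dcl + \<kappa> /\<^sub>R 6)" and ?\<beta> = "d\<psi> - cu \<bullet> (dcl + \<kappa> /\<^sub>R 6)"
  define \<omega> where "\<omega> = ?\<omega>"
  define \<alpha> where "\<alpha> = ?\<alpha>"
  define \<beta> where "\<beta> = ?\<beta>"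
  define \<eta> where "\<eta> = dcu - Re \<tau> *\<^sub>R db"
  define \<rho> where "\<rho> = (Im \<tau>)\<^sup>2 / 2 * h t"
  define v where "v = IIA_of_IIB_deriv k p w"
  have ht: "h t > 0" by (rule h_pos[OF t])
  have 6: "k3 k t t t = 6 * h t" by (simp add: cubic_eq_k3)
  define x where "x = cu - Re \<tau> *\<^sub>R b"
  define dx where "dx = dcu - Re d\<tau> *\<^sub>R b - Re \<tau> *\<^sub>R db"
  define d\<rho> where "d\<rho> = Im \<tau> * Im d\<tau> * h t + (Im \<tau>)\<^sup>2 / 4 * k3 k t t dt"
  define d\<zeta>' where "d\<zeta>' = cons_vec (dc0 - (2 * k3 k b db x + k3 k b b dx) / 6)
      (dcl + (k2 k db x + k2 k b dx) /\<^sub>R 2)"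
  define d\<zeta> where "d\<zeta> = cons_vec (Re d\<tau>) (- dx)"
  define d\<sigma> where "d\<sigma> = - 2 * d\<psi> - Re d\<tau> * c0 - Re \<tau> * dc0 + dcl \<bullet> x + cl \<bullet> dx
           - (k3 k db cu x + k3 k b dcu x + k3 k b cu dx) / 6"
  have v: "v = (dz, d\<rho>, d\<zeta>', d\<zeta>, d\<sigma>)"
    unfolding v_def p_def w_def IIA_of_IIB_deriv_def Let_def prod.case d\<rho>_def d\<zeta>'_def d\<zeta>_def d\<sigma>_def
      x_def[symmetric] dx_def[symmetric] b_def[symmetric] db_def[symmetric] t_def[symmetric] dt_def[symmetric]
    by (simp add: k3_ac)
  define \<zeta>' where "\<zeta>' = cons_vec (c0 - k3 k b b x / 6) (cl + k2 k b x /\<^sub>R 2)"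
  define \<zeta> where "\<zeta> = cons_vec (Re \<tau>) (- x)"
  define \<sigma> where "\<sigma> = - 2 * \<psi> - Re \<tau> * c0 + cl \<bullet> x - k3 k b cu x / 6"
  have p: "IIA_of_IIB k p = (z, \<rho>, \<zeta>', \<zeta>, \<sigma>)"
    unfolding p_def IIA_of_IIB_eq Let_def \<rho>_def \<zeta>'_def \<zeta>_def \<sigma>_def x_def b_def t_def ..
  note W = W_form_components[OF v, of z, folded b_def t_def]
  have d\<zeta>: "tail d\<zeta> = - dx" "d\<zeta> $ None = Re d\<tau>" by (simp_all add: d\<zeta>_def)
  note linear = k2_linear k3_linear k3_linear_real inner_add_left inner_add_right inner_diff_left
    inner_diff_right inner_k2
  have P: "tail (re_W z v) = \<omega> + (Re d\<tau> / 2) *\<^sub>R k2 k t t"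
    unfolding W d\<zeta> unfolding d\<zeta>'_def \<omega>_def \<kappa>_def x_def dx_def vec_eq_iff
    by (simp add: k2_linear k2_commute algebra_simps)
  have R: "tail (im_W z v) = - k2 k t \<eta>"
    unfolding W d\<zeta> dx_def \<eta>_def by (simp add: k2_linear k2_commute algebra_simps)
  have A: "re_W z v $ None + b \<bullet> tail (re_W z v) = \<alpha> - k3 k t t \<eta> / 2"
    unfolding P unfolding W d\<zeta> unfolding d\<zeta>'_def \<omega>_def \<alpha>_def \<kappa>_def \<eta>_def x_def dx_def
    by (simp add: linear k3_ac cubic_eq_k3 field_simps)
  have B: "im_W z v $ None + b \<bullet> tail (im_W z v) = - 2 * h t * Re d\<tau>"
    unfolding R unfolding W d\<zeta> \<eta>_def dx_def
    by (simp add: linear k3_ac cubic_eq_k3 field_simps)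
  have S: "sigma_form (z, \<rho>, \<zeta>', \<zeta>, \<sigma>) v = - 2 * (\<beta> + Re \<tau> * \<alpha>)"
    unfolding v sigma_form_inner inner_option
    unfolding d\<zeta>'_def d\<zeta>_def d\<sigma>_def \<zeta>'_def \<zeta>_def \<alpha>_def \<beta>_def \<kappa>_def x_def dx_def
    by (simp add: linear k3_ac inner_commute field_simps)
  define D where "D = k3 k t t dt"
  have \<nu>: "k3 k t t ?\<nu> = D + 3 * h t * Im d\<tau> / Im \<tau>"
    "k3 k t ?\<nu> ?\<nu> = k3 k t dt dt + Im d\<tau> / Im \<tau> * D + 3 * h t * (Im d\<tau>)\<^sup>2 / (2 * (Im \<tau>)\<^sup>2)"
    using \<tau> unfolding D_def by (simp_all add: k3_linear k3_linear_real 6 k3_ac power2_eq_square field_simps)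
  have kinv: "k2_inv t (k2 k t y) = y" "k2 k t (k2_inv t y) = y" for y by (simp_all add: k2_inv[OF t])
  have kinv_linear: "k2_inv t (x + y) = k2_inv t x + k2_inv t y" "k2_inv t (r *\<^sub>R x) = r *\<^sub>R k2_inv t x"
    "k2_inv t (- x) = - k2_inv t x" for r x y
    using linear_k2_inv[OF t] by (simp_all add: linear_add linear_scale linear_neg)
  have "k2 k t t \<bullet> k2_inv t \<omega> = t \<bullet> \<omega>"
  proof -
    have "k2 k t t \<bullet> k2_inv t \<omega> = t \<bullet> k2 k t (k2_inv t \<omega>)" by (simp add: inner_k2 k3_ac)
    then show ?thesis by (simp only: kinv)
  qed
  then have PP: "tail (re_W z v) \<bullet> k2_inv t (tail (re_W z v)) =
      \<omega> \<bullet> k2_inv t \<omega> + Re d\<tau> * (t \<bullet> \<omega>) + 3 * h t * (Re d\<tau>)\<^sup>2 / 2"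
    unfolding P by (simp add: kinv_linear kinv inner_add_left inner_add_right inner_k2 inner_commute[of \<omega> t] 6
        power2_eq_square algebra_simps)
  have RR: "tail (im_W z v) \<bullet> k2_inv t (tail (im_W z v)) = k3 k t \<eta> \<eta>"
    unfolding R by (simp add: kinv_linear kinv inner_k2 k3_ac)
  have tP: "t \<bullet> tail (re_W z v) = t \<bullet> \<omega> + 3 * h t * Re d\<tau>"
    unfolding P by (simp add: inner_add_right inner_k2 6)
  have tR: "t \<bullet> tail (im_W z v) = - k3 k t t \<eta>"
    unfolding R by (simp add: inner_k2)
  \<comment> \<open>The square of \<open>d\<rho> / \<rho>\<close> has a mixed term in
    \<open>dt\<close> and \<open>Im d\<tau>\<close>. The shift by a multiple of \<open>t\<close> in
    \<open>\<nu>\<close> absorbs it, and what remains is the \<open>Im d\<tau>\<close> part of the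
    invariant metric of the upper half-plane.\<close>
  have 1: "ln_metric t dt + d\<rho>\<^sup>2 / (4 * \<rho>\<^sup>2) =
      (k3 k t t ?\<nu>)\<^sup>2 / (8 * (h t)\<^sup>2) - k3 k t ?\<nu> ?\<nu> / (4 * h t) + (Im d\<tau>)\<^sup>2 / (4 * (Im \<tau>)\<^sup>2)"
    using ht \<tau> unfolding \<nu> d\<rho>_def \<rho>_def D_def[symmetric]
    by (simp add: power2_eq_square field_simps)
  \<comment> \<open>The two squares containing \<open>\<alpha>\<close> are those of
    \<open>\<alpha>\<close> minus and plus half of \<open>k3 k t t \<eta>\<close>, so their mixed
    terms cancel. The mixed term of \<open>Re d\<tau>\<close> and
    \<open>t \<bullet> \<omega>\<close> from \<open>PP\<close> cancels against the one in the last
    square.\<close>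
  have 2: "((\<omega> \<bullet> k2_inv t \<omega> + Re d\<tau> * (t \<bullet> \<omega>) + 3 * h t * (Re d\<tau>)\<^sup>2 / 2 + k3 k t \<eta> \<eta>) / 2
        - ((\<alpha> - k3 k t t \<eta> / 2)\<^sup>2 + (- 2 * h t * Re d\<tau>)\<^sup>2 + ((\<alpha> - k3 k t t \<eta> / 2) - - k3 k t t \<eta>)\<^sup>2
            + (- 2 * h t * Re d\<tau> + (t \<bullet> \<omega> + 3 * h t * Re d\<tau>))\<^sup>2) / (4 * h t)) / (4 * \<rho>) =
     - (Re d\<tau>)\<^sup>2 / (4 * (Im \<tau>)\<^sup>2) - ln_metric t \<eta> / (Im \<tau>)\<^sup>2
     + (\<omega> \<bullet> k2_inv t \<omega> - (t \<bullet> \<omega>)\<^sup>2 / (2 * h t)) / (4 * (Im \<tau>)\<^sup>2 * h t)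
     - (Im \<tau>)\<^sup>2 * \<alpha>\<^sup>2 / (4 * (Im \<tau>) ^ 4 * (h t)\<^sup>2)"
    using ht \<tau> unfolding \<rho>_def
    by (simp add: power2_eq_square power4_eq_xxxx field_simps)
  have 3: "(- 2 * (\<beta> + Re \<tau> * \<alpha>))\<^sup>2 / (64 * \<rho>\<^sup>2) = (\<beta> + Re \<tau> * \<alpha>)\<^sup>2 / (4 * (Im \<tau>) ^ 4 * (h t)\<^sup>2)"
    using ht \<tau> unfolding \<rho>_def
    by (simp add: power2_eq_square power4_eq_xxxx field_simps)
  have "qmap_metric k (IIA_of_IIB k p) v v = ln_metric t db + (ln_metric t dt + d\<rho>\<^sup>2 / (4 * \<rho>\<^sup>2))
      - ((\<omega> \<bullet> k2_inv t \<omega> + Re d\<tau> * (t \<bullet> \<omega>) + 3 * h t * (Re d\<tau>)\<^sup>2 / 2 + k3 k t \<eta> \<eta>) / 2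
        - ((\<alpha> - k3 k t t \<eta> / 2)\<^sup>2 + (- 2 * h t * Re d\<tau>)\<^sup>2 + ((\<alpha> - k3 k t t \<eta> / 2) - - k3 k t t \<eta>)\<^sup>2
            + (- 2 * h t * Re d\<tau> + (t \<bullet> \<omega> + 3 * h t * Re d\<tau>))\<^sup>2) / (4 * h t)) / (4 * \<rho>)
      + (- 2 * (\<beta> + Re \<tau> * \<alpha>))\<^sup>2 / (64 * \<rho>\<^sup>2)"
    unfolding p qmap_metric_quadratic[OF t[unfolded t_def], folded b_def t_def] PP RR A B tP tR S
    by (simp only: v fst_conv snd_conv db_def dt_def add.assoc)
  then have "qmap_metric k (IIA_of_IIB k p) v v = IIB_form t \<tau> ?\<nu> d\<tau> db dcu \<omega> \<alpha> \<beta>"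
    unfolding 1 2 3 unfolding IIB_form_def cmod_power2 \<eta>_def[symmetric]
    by (simp only: add_divide_distrib diff_divide_distrib)
  then show ?thesis
    unfolding v_def \<omega>_def \<alpha>_def \<beta>_def \<kappa>_def p_def w_def IIB_metric_def Let_def prod.case
      b_def t_def db_def dt_def .
qed

end

section \<open>Invariance under S-duality\<close>

definition mk_vec :: "real ^ 'n \<Rightarrow> real ^ 'n \<Rightarrow> complex ^ 'n::finite" where
  "mk_vec x y = (\<chi> i. Complex (x $ i) (y $ i))"

lemma mk_vec_simps [simp]: "Re_vec (mk_vec x y) = x" "Im_vec (mk_vec x y) = y"
  by (simp_all add: mk_vec_def vec_eq_iff)

lemma bounded_linear_mk_vec: "bounded_linear (\<lambda>p. mk_vec (fst p) (snd p))"
  unfolding linear_conv_bounded_linear[symmetric]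
  by (auto intro!: linearI simp: vec_eq_iff mk_vec_def complex_eq_iff)

lemma has_derivative_mk_vec [derivative_intros]:
  assumes "(f has_derivative f') (at x within S)" "(g has_derivative g') (at x within S)"
  shows "((\<lambda>x. mk_vec (f x) (g x)) has_derivative (\<lambda>v. mk_vec (f' v) (g' v))) (at x within S)"
  using bounded_linear.has_derivative[OF bounded_linear_mk_vec has_derivative_Pair[OF assms]] by simp

lemma S_duality_IIB_eq:
  fixes A :: "real ^ 2 ^ 2"
  defines "a \<equiv> A $ 1 $ 1" and "b \<equiv> A $ 1 $ 2" and "c \<equiv> A $ 2 $ 1" and "d \<equiv> A $ 2 $ 2"
  shows "S_duality_IIB A (z, \<tau>, cu, cl, c0, \<psi>) =
    (mk_vec (c *\<^sub>R cu + d *\<^sub>R Re_vec z) (cmod (of_real c * \<tau> + of_real d) *\<^sub>R Im_vec z),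
     (of_real a * \<tau> + of_real b) / (of_real c * \<tau> + of_real d),
     a *\<^sub>R cu + b *\<^sub>R Re_vec z, cl, d * c0 - c * \<psi>, - b * c0 + a * \<psi>)"
  by (simp add: S_duality_IIB_def Let_def mk_vec_def vec_eq_iff a_def b_def c_def d_def)

lemma det_SL2: "det A = A $ 1 $ 1 * A $ 2 $ 2 - A $ 1 $ 2 * A $ 2 $ 1" for A :: "real ^ 2 ^ 2"
  by (rule det_2)

lemma moebius_denominator_nonzero:
  fixes c d :: real
  assumes "Im \<tau> > 0" "c \<noteq> 0 \<or> d \<noteq> 0"
  shows "of_real c * \<tau> + of_real d \<noteq> 0"
  using assms by (auto simp: complex_eq_iff)

lemma cmod_moebius_denominator:
  "(cmod (of_real c * \<tau> + of_real d))\<^sup>2 = (c * Re \<tau> + d)\<^sup>2 + (c * Im \<tau>)\<^sup>2"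
  by (simp add: cmod_power2)

text \<open>The last two quantities are the coefficients of \<open>dcu\<close> and \<open>db\<close>
  in the transformed \<open>dcu - Re \<tau> *\<^sub>R db\<close>, and also those of
  \<open>\<beta>\<close> and \<open>- \<alpha>\<close> in the transformed
  \<open>\<beta> + Re \<tau> * \<alpha>\<close>. All three follow on extending the fraction by the
  conjugate of \<open>\<mu>\<close>.\<close>

lemma moebius_Re_Im:
  fixes a b c d :: real
  assumes "Im \<tau> > 0" and det: "a * d - b * c = 1"
  defines "\<mu> \<equiv> of_real c * \<tau> + of_real d"
  defines "\<tau>' \<equiv> (of_real a * \<tau> + of_real b) / \<mu>"
  shows "Im \<tau>' = Im \<tau> / (cmod \<mu>)\<^sup>2"
    "a - Re \<tau>' * c = (c * Re \<tau> + d) / (cmod \<mu>)\<^sup>2"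
    "b - Re \<tau>' * d = - ((c * Re \<tau> + d) * Re \<tau> + c * (Im \<tau>)\<^sup>2) / (cmod \<mu>)\<^sup>2"
proof -
  let ?s = "c * Re \<tau> + d"
  have "c \<noteq> 0 \<or> d \<noteq> 0" using det by auto
  then have "\<mu> \<noteq> 0" using moebius_denominator_nonzero assms(1) unfolding \<mu>_def by blast
  then have pos: "(cmod \<mu>)\<^sup>2 > 0" by simp
  have l: "(cmod \<mu>)\<^sup>2 = ?s\<^sup>2 + (c * Im \<tau>)\<^sup>2"
    unfolding \<mu>_def by (rule cmod_moebius_denominator)
  have "\<tau>' = (of_real a * \<tau> + of_real b) * cnj \<mu> / of_real ((cmod \<mu>)\<^sup>2)"
    unfolding \<tau>'_def by (simp add: complex_div_cnj[of _ \<mu>])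
  then have Re: "Re \<tau>' = ((a * Re \<tau> + b) * ?s + a * c * (Im \<tau>)\<^sup>2) / (cmod \<mu>)\<^sup>2"
    and Im: "Im \<tau>' = (a * Im \<tau> * ?s - (a * Re \<tau> + b) * (c * Im \<tau>)) / (cmod \<mu>)\<^sup>2"
    by (simp_all add: \<mu>_def power2_eq_square algebra_simps del: of_real_power)
  have "a * Im \<tau> * ?s - (a * Re \<tau> + b) * (c * Im \<tau>) = (a * d - b * c) * Im \<tau>"
    by (simp add: algebra_simps)
  then show "Im \<tau>' = Im \<tau> / (cmod \<mu>)\<^sup>2" unfolding Im det by simp
  have "a * (?s\<^sup>2 + (c * Im \<tau>)\<^sup>2) - ((a * Re \<tau> + b) * ?s + a * c * (Im \<tau>)\<^sup>2) * c = (a * d - b * c) * ?s"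
    by (simp add: power2_eq_square algebra_simps)
  then show "a - Re \<tau>' * c = ?s / (cmod \<mu>)\<^sup>2"
    unfolding Re det using pos by (simp add: field_simps l)
  have "b * (?s\<^sup>2 + (c * Im \<tau>)\<^sup>2) - ((a * Re \<tau> + b) * ?s + a * c * (Im \<tau>)\<^sup>2) * d
      = - (a * d - b * c) * (?s * Re \<tau> + c * (Im \<tau>)\<^sup>2)"
    by (simp add: power2_eq_square algebra_simps)
  then show "b - Re \<tau>' * d = - (?s * Re \<tau> + c * (Im \<tau>)\<^sup>2) / (cmod \<mu>)\<^sup>2"
    unfolding Re det using pos by (simp add: field_simps l)
qed

section \<open>Scaling and invariance of the summands\<close>

context psr
begin

lemma ln_metric_scaleR:
  assumes "r > 0"
  shows "ln_metric (r *\<^sub>R t) v = ln_metric t v / r\<^sup>2"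
  using assms
  by (cases "h t = 0") (simp_all add: k3_linear_real cubic_scaleR power2_eq_square power3_eq_cube field_simps)

lemma k2_inv_scaleR:
  assumes "t \<in> U" "r > 0"
  shows "k2_inv (r *\<^sub>R t) w = k2_inv t w /\<^sub>R r"
proof -
  have "w = k2 k (r *\<^sub>R t) (k2_inv t w /\<^sub>R r)"
    using assms by (simp add: k2_linear k2_inv(1)[OF assms(1)])
  then show ?thesis using k2_inv(2)[OF cone_scaleR[OF assms]] by metis
qed

lemma ln_metric_combination:
  "ln_metric t (x *\<^sub>R v + y *\<^sub>R w) = x\<^sup>2 * ln_metric t v
    + 2 * x * y * (k3 k t t v * k3 k t t w / (16 * (h t)\<^sup>2) - k3 k t v w / (4 * h t)) + y\<^sup>2 * ln_metric t w"
proof -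
  have "(x * p + y * q)\<^sup>2 / A - (x\<^sup>2 * e + 2 * x * y * f + y\<^sup>2 * g) / B
      = x\<^sup>2 * (p\<^sup>2 / A - e / B) + 2 * x * y * (p * q / A - f / B) + y\<^sup>2 * (q\<^sup>2 / A - g / B)"
    for A B p q e f g :: real
    by (simp add: diff_divide_distrib add_divide_distrib power2_eq_square algebra_simps)
  moreover have "k3 k t (x *\<^sub>R v + y *\<^sub>R w) (x *\<^sub>R v + y *\<^sub>R w)
      = x\<^sup>2 * k3 k t v v + 2 * x * y * k3 k t v w + y\<^sup>2 * k3 k t w w"
    by (simp add: k3_linear k3_linear_real k3_ac power2_eq_square algebra_simps)
  moreover have "k3 k t t (x *\<^sub>R v + y *\<^sub>R w) = x * k3 k t t v + y * k3 k t t w"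
    by (simp add: k3_linear k3_linear_real)
  ultimately show ?thesis by simp
qed

lemma IIB_form_SL2:
  assumes t: "t \<in> U" and \<tau>: "Im \<tau> > 0" and det: "a * d - b * c = 1"
  defines "\<mu> \<equiv> of_real c * \<tau> + of_real d"
  shows "IIB_form (cmod \<mu> *\<^sub>R t) ((of_real a * \<tau> + of_real b) / \<mu>) (cmod \<mu> *\<^sub>R \<nu>) (d\<tau> / \<mu>\<^sup>2)
      (c *\<^sub>R dcu + d *\<^sub>R db) (a *\<^sub>R dcu + b *\<^sub>R db) \<omega> (d * \<alpha> - c * \<beta>) (- b * \<alpha> + a * \<beta>)
    = IIB_form t \<tau> \<nu> d\<tau> db dcu \<omega> \<alpha> \<beta>"
proof -
  define s where "s = c * Re \<tau> + d"
  define T where "T = Im \<tau>"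
  define u where "u = s * Re \<tau> + c * T\<^sup>2"
  define r where "r = cmod \<mu>"
  define \<tau>' where "\<tau>' = (of_real a * \<tau> + of_real b) / \<mu>"
  have ht: "h t > 0" by (rule h_pos[OF t])
  have T: "T > 0" using \<tau> by (simp add: T_def)
  have "c \<noteq> 0 \<or> d \<noteq> 0" using det by auto
  then have "\<mu> \<noteq> 0" using moebius_denominator_nonzero \<tau> unfolding \<mu>_def by blast
  then have r: "r > 0" by (simp add: r_def)
  have r2: "r\<^sup>2 = s\<^sup>2 + c\<^sup>2 * T\<^sup>2"
    unfolding r_def \<mu>_def cmod_moebius_denominator s_def T_def by (simp add: power_mult_distrib)
  have \<tau>': "Im \<tau>' = T / r\<^sup>2" "a - Re \<tau>' * c = s / r\<^sup>2" "b - Re \<tau>' * d = - u / r\<^sup>2"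
    using moebius_Re_Im[OF \<tau> det] unfolding \<tau>'_def \<mu>_def r_def s_def u_def T_def by simp_all
  \<comment> \<open>Up to a factor \<open>r ^ 4\<close>, the left sides are the coefficients of the
    squared modulus of the transformed \<open>dcu - \<tau> db\<close> as a quadratic form in
    \<open>dcu\<close> and \<open>db\<close>. The right sides say that this expression is divided by
    \<open>\<mu>\<close>.\<close>
  have quad: "s\<^sup>2 + c\<^sup>2 * T\<^sup>2 = r\<^sup>2" "- s * u + c * d * T\<^sup>2 = - r\<^sup>2 * Re \<tau>"
    "u\<^sup>2 + d\<^sup>2 * T\<^sup>2 = r\<^sup>2 * ((Re \<tau>)\<^sup>2 + T\<^sup>2)"
    unfolding r2 u_def s_def by (simp_all add: power2_eq_square algebra_simps)
  have 1: "(k3 k (r *\<^sub>R t) (r *\<^sub>R t) (r *\<^sub>R \<nu>))\<^sup>2 / (8 * (h (r *\<^sub>R t))\<^sup>2) - k3 k (r *\<^sub>R t) (r *\<^sub>R \<nu>) (r *\<^sub>R \<nu>) / (4 * h (r *\<^sub>R t))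
      = (k3 k t t \<nu>)\<^sup>2 / (8 * (h t)\<^sup>2) - k3 k t \<nu> \<nu> / (4 * h t)"
    using r ht by (simp add: k3_linear_real cubic_scaleR power2_eq_square power3_eq_cube field_simps)
  have 2: "(cmod (d\<tau> / \<mu>\<^sup>2))\<^sup>2 / (4 * (T / r\<^sup>2)\<^sup>2) = (cmod d\<tau>)\<^sup>2 / (4 * T\<^sup>2)"
    using r T by (simp add: norm_divide norm_power r_def[symmetric] field_simps)
  have 3: "ln_metric (r *\<^sub>R t) (a *\<^sub>R dcu + b *\<^sub>R db - Re \<tau>' *\<^sub>R (c *\<^sub>R dcu + d *\<^sub>R db)) / (T / r\<^sup>2)\<^sup>2
        + ln_metric (r *\<^sub>R t) (c *\<^sub>R dcu + d *\<^sub>R db)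
      = ln_metric t (dcu - Re \<tau> *\<^sub>R db) / T\<^sup>2 + ln_metric t db"
  proof -
    have e: "a *\<^sub>R dcu + b *\<^sub>R db - Re \<tau>' *\<^sub>R (c *\<^sub>R dcu + d *\<^sub>R db) = (s / r\<^sup>2) *\<^sub>R dcu + (- u / r\<^sup>2) *\<^sub>R db"
      unfolding \<tau>'(2,3)[symmetric] by (simp add: algebra_simps)
    have e': "dcu - Re \<tau> *\<^sub>R db = 1 *\<^sub>R dcu + (- Re \<tau>) *\<^sub>R db" by simp
    define p where "p = ln_metric t dcu"
    define q where "q = k3 k t t dcu * k3 k t t db / (16 * (h t)\<^sup>2) - k3 k t dcu db / (4 * h t)"
    define g where "g = ln_metric t db"
    have "((s / r\<^sup>2)\<^sup>2 * p + 2 * (s / r\<^sup>2) * (- u / r\<^sup>2) * q + (- u / r\<^sup>2)\<^sup>2 * g) / r\<^sup>2 / (T / r\<^sup>2)\<^sup>2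
        + (c\<^sup>2 * p + 2 * c * d * q + d\<^sup>2 * g) / r\<^sup>2
      = ((s\<^sup>2 + c\<^sup>2 * T\<^sup>2) * p + 2 * (- s * u + c * d * T\<^sup>2) * q + (u\<^sup>2 + d\<^sup>2 * T\<^sup>2) * g) / (r\<^sup>2 * T\<^sup>2)"
      using r T by (simp add: field_simps)
    also have "\<dots> = (p + 2 * (- Re \<tau>) * q + (Re \<tau>)\<^sup>2 * g) / T\<^sup>2 + g"
      unfolding quad using r T by (simp add: field_simps)
    finally show ?thesis
      unfolding e e' ln_metric_scaleR[OF r] unfolding ln_metric_combination p_def q_def g_def by simp
  qed
  \<comment> \<open>The powers of \<open>r\<close> cancel: the numerator has degree -1, and the
    denominator has -4 from the square of the imaginary part and 3 from \<open>h\<close>.\<close>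
  have 4: "(\<omega> \<bullet> k2_inv (r *\<^sub>R t) \<omega> - (r *\<^sub>R t \<bullet> \<omega>)\<^sup>2 / (2 * h (r *\<^sub>R t))) / (4 * (T / r\<^sup>2)\<^sup>2 * h (r *\<^sub>R t))
      = (\<omega> \<bullet> k2_inv t \<omega> - (t \<bullet> \<omega>)\<^sup>2 / (2 * h t)) / (4 * T\<^sup>2 * h t)"
    unfolding k2_inv_scaleR[OF t r] using r T ht
    by (simp add: cubic_scaleR power2_eq_square power3_eq_cube field_simps)
  have 5: "((T / r\<^sup>2)\<^sup>2 * (d * \<alpha> - c * \<beta>)\<^sup>2 + (- b * \<alpha> + a * \<beta> + Re \<tau>' * (d * \<alpha> - c * \<beta>))\<^sup>2)
        / (4 * (T / r\<^sup>2) ^ 4 * (h (r *\<^sub>R t))\<^sup>2)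
      = (T\<^sup>2 * \<alpha>\<^sup>2 + (\<beta> + Re \<tau> * \<alpha>)\<^sup>2) / (4 * T ^ 4 * (h t)\<^sup>2)"
  proof -
    have e: "- b * \<alpha> + a * \<beta> + Re \<tau>' * (d * \<alpha> - c * \<beta>) = (s / r\<^sup>2) * \<beta> - (- u / r\<^sup>2) * \<alpha>"
      unfolding \<tau>'(2,3)[symmetric] by (simp add: algebra_simps)
    have "(T / r\<^sup>2)\<^sup>2 * (d * \<alpha> - c * \<beta>)\<^sup>2 + ((s / r\<^sup>2) * \<beta> - (- u / r\<^sup>2) * \<alpha>)\<^sup>2
      = ((s\<^sup>2 + c\<^sup>2 * T\<^sup>2) * \<beta>\<^sup>2 - 2 * (- s * u + c * d * T\<^sup>2) * (\<alpha> * \<beta>) + (u\<^sup>2 + d\<^sup>2 * T\<^sup>2) * \<alpha>\<^sup>2) / r ^ 4"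
      using r by (simp add: power2_eq_square power4_eq_xxxx field_simps)
    also have "\<dots> = (T\<^sup>2 * \<alpha>\<^sup>2 + (\<beta> + Re \<tau> * \<alpha>)\<^sup>2) / r\<^sup>2"
      unfolding quad using r by (simp add: power2_eq_square power4_eq_xxxx field_simps)
    finally have num: "(T / r\<^sup>2)\<^sup>2 * (d * \<alpha> - c * \<beta>)\<^sup>2 + ((s / r\<^sup>2) * \<beta> - (- u / r\<^sup>2) * \<alpha>)\<^sup>2
        = (T\<^sup>2 * \<alpha>\<^sup>2 + (\<beta> + Re \<tau> * \<alpha>)\<^sup>2) / r\<^sup>2" .
    have den: "4 * (T / r\<^sup>2) ^ 4 * (r ^ 3 * h t)\<^sup>2 = 4 * T ^ 4 * (h t)\<^sup>2 / r\<^sup>2"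
      using r by (simp add: power_mult_distrib power_divide field_simps flip: power_mult power_add)
    show ?thesis
      unfolding e cubic_scaleR num den using r by simp
  qed
  show ?thesis
    unfolding IIB_form_def \<tau>'_def[symmetric] r_def[symmetric] \<tau>'(1) 1 2 3 4 5 unfolding T_def ..
qed

text \<open>\<open>(of_real c * d\<tau>) \<bullet> sgn \<mu>\<close> is the differential of
  \<open>cmod \<mu>\<close>. The Moebius map has derivative (a d - b c) /
  \<open>\<mu>\<^sup>2\<close>, with numerator 1 on SL(2, R).\<close>

definition S_duality_IIB_deriv :: "real ^ 2 ^ 2 \<Rightarrow> 'n IIB \<Rightarrow> 'n IIB \<Rightarrow> 'n IIB" where
  "S_duality_IIB_deriv A = (\<lambda>(z, \<tau>, cu, cl, c0, \<psi>) (dz, d\<tau>, dcu, dcl, dc0, d\<psi>).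
     let a = A $ 1 $ 1; b = A $ 1 $ 2; c = A $ 2 $ 1; d = A $ 2 $ 2;
         \<mu> = of_real c * \<tau> + of_real d
     in (mk_vec (c *\<^sub>R dcu + d *\<^sub>R Re_vec dz)
           (cmod \<mu> *\<^sub>R Im_vec dz + ((of_real c * d\<tau>) \<bullet> sgn \<mu>) *\<^sub>R Im_vec z),
         d\<tau> / \<mu>\<^sup>2, a *\<^sub>R dcu + b *\<^sub>R Re_vec dz, dcl, d * dc0 - c * d\<psi>, - b * dc0 + a * d\<psi>))"

lemma S_duality_IIB_has_derivative:
  assumes p: "p \<in> IIB_domain H" and det: "det A = 1"
  shows "(S_duality_IIB A has_derivative S_duality_IIB_deriv A p) (at p)"
proof -
  define a b c d where abcd: "a = A $ 1 $ 1" "b = A $ 1 $ 2" "c = A $ 2 $ 1" "d = A $ 2 $ 2"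
  have det': "a * d - b * c = 1" using det unfolding det_SL2 abcd .
  have eq: "S_duality_IIB A = (\<lambda>p.
     (mk_vec (c *\<^sub>R fst (snd (snd p)) + d *\<^sub>R Re_vec (fst p))
        (norm (of_real c * fst (snd p) + of_real d) *\<^sub>R Im_vec (fst p)),
     (of_real a * fst (snd p) + of_real b) / (of_real c * fst (snd p) + of_real d),
     a *\<^sub>R fst (snd (snd p)) + b *\<^sub>R Re_vec (fst p), fst (snd (snd (snd p))),
     d * fst (snd (snd (snd (snd p)))) - c * snd (snd (snd (snd (snd p)))),
     - b * fst (snd (snd (snd (snd p)))) + a * snd (snd (snd (snd (snd p))))))"
    by (rule ext) (clarsimp simp: S_duality_IIB_eq abcd)
  have "Im (fst (snd p)) > 0" using p unfolding IIB_domain_def by auto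
  moreover have "c \<noteq> 0 \<or> d \<noteq> 0" using det' by auto
  ultimately have \<mu>: "of_real c * fst (snd p) + of_real d \<noteq> 0"
    using moebius_denominator_nonzero by blast
  have norm: "((\<lambda>p. norm (of_real c * fst (snd p) + of_real d)) has_derivative
      (\<lambda>w. (of_real c * fst (snd w)) \<bullet> sgn (of_real c * fst (snd p) + of_real d))) (at p)"
    by (rule has_derivative_compose[where f = "\<lambda>p. of_real c * fst (snd p) + of_real d", OF _ has_derivative_norm[OF \<mu>]])
      (auto intro!: derivative_eq_intros)
  have "of_real a * (of_real c * \<tau> + of_real d) - (of_real a * \<tau> + of_real b) * of_real c = (1 :: complex)" for \<tau>
  proof -
    have "of_real a * (of_real c * \<tau> + of_real d) - (of_real a * \<tau> + of_real b) * of_real c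
        = complex_of_real (a * d - b * c)" by (simp add: algebra_simps)
    then show ?thesis unfolding det' by simp
  qed
  then have "((\<lambda>\<tau>. (of_real a * \<tau> + of_real b) / (of_real c * \<tau> + of_real d)) has_field_derivative
      1 / (of_real c * fst (snd p) + of_real d)\<^sup>2) (at (fst (snd p)))"
    using \<mu> by (auto intro!: derivative_eq_intros simp: power2_eq_square)
  then have moebius: "((\<lambda>p. (of_real a * fst (snd p) + of_real b) / (of_real c * fst (snd p) + of_real d)) has_derivative
      (\<lambda>w. fst (snd w) / (of_real c * fst (snd p) + of_real d)\<^sup>2)) (at p)"
    using has_derivative_compose[of "\<lambda>p. fst (snd p)" "\<lambda>w. fst (snd w)" p UNIV]
      has_derivative_fst[OF has_derivative_snd[OF has_derivative_ident]]
    by (fastforce simp: has_field_derivative_def)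
  obtain z \<tau> cu cl c0 \<psi> where p_eq: "p = (z, \<tau>, cu, cl, c0, \<psi>)" by (cases p)
  show ?thesis
    unfolding eq
    by (rule has_derivative_eq_rhs, (rule norm moebius derivative_intros)+)
      (clarsimp simp: fun_eq_iff S_duality_IIB_deriv_def Let_def abcd p_eq)
qed

lemma S_duality_IIB_in_domain:
  assumes p: "p \<in> IIB_domain H" and det: "det A = 1"
  shows "S_duality_IIB A p \<in> IIB_domain H"
proof -
  obtain z \<tau> cu cl c0 \<psi> where p_eq: "p = (z, \<tau>, cu, cl, c0, \<psi>)" by (cases p)
  define a b c d where abcd: "a = A $ 1 $ 1" "b = A $ 1 $ 2" "c = A $ 2 $ 1" "d = A $ 2 $ 2"
  have det': "a * d - b * c = 1" using det unfolding det_SL2 abcd .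
  have \<tau>: "Im \<tau> > 0" and t: "Im_vec z \<in> U"
    using p unfolding p_eq IIB_domain_def tube_domain_def by auto
  have "c \<noteq> 0 \<or> d \<noteq> 0" using det' by auto
  then have \<mu>: "of_real c * \<tau> + of_real d \<noteq> 0"
    using moebius_denominator_nonzero \<tau> by blast
  then show ?thesis
    using moebius_Re_Im(1)[OF \<tau> det'] \<tau> cone_scaleR[OF t]
    unfolding p_eq S_duality_IIB_eq IIB_domain_def tube_domain_def abcd[symmetric] by simp
qed

lemma IIB_metric_S_duality_IIB:
  assumes p: "p \<in> IIB_domain H" and det: "det A = 1"
  shows "IIB_metric (S_duality_IIB A p) (S_duality_IIB_deriv A p w) = IIB_metric p w"
proof -
  obtain z \<tau> cu cl c0 \<psi> where p_eq: "p = (z, \<tau>, cu, cl, c0, \<psi>)" by (cases p)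
  obtain dz d\<tau> dcu dcl dc0 d\<psi> where w_eq: "w = (dz, d\<tau>, dcu, dcl, dc0, d\<psi>)" by (cases w)
  define a b c d where abcd: "a = A $ 1 $ 1" "b = A $ 1 $ 2" "c = A $ 2 $ 1" "d = A $ 2 $ 2"
  have det': "a * d - b * c = 1" using det unfolding det_SL2 abcd .
  have \<tau>: "Im \<tau> > 0" and t: "Im_vec z \<in> U"
    using p unfolding p_eq IIB_domain_def tube_domain_def by auto
  define \<mu> where "\<mu> = of_real c * \<tau> + of_real d"
  have "c \<noteq> 0 \<or> d \<noteq> 0" using det' by auto
  then have \<mu>: "\<mu> \<noteq> 0"
    using moebius_denominator_nonzero \<tau> unfolding \<mu>_def by blast
  define r where "r = cmod \<mu>"
  have r: "r > 0" using \<mu> by (simp add: r_def)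
  define dr where "dr = (of_real c * d\<tau>) \<bullet> sgn \<mu>"
  let ?t = "Im_vec z" and ?b = "Re_vec z" and ?dt = "Im_vec dz" and ?db = "Re_vec dz"
  let ?\<tau>' = "(of_real a * \<tau> + of_real b) / \<mu>"
  have Im': "Im ?\<tau>' = Im \<tau> / r\<^sup>2"
    using moebius_Re_Im(1)[OF \<tau> det'] unfolding \<mu>_def r_def .
  have dr: "r * dr = c * ((c * Re \<tau> + d) * Re d\<tau> + c * Im \<tau> * Im d\<tau>)"
    using r unfolding dr_def sgn_div_norm r_def[symmetric]
    by (simp add: \<mu>_def inner_complex_def field_simps)
  have r2: "r\<^sup>2 = (c * Re \<tau> + d)\<^sup>2 + (c * Im \<tau>)\<^sup>2"
    unfolding r_def \<mu>_def by (rule cmod_moebius_denominator)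
  \<comment> \<open>This is the differential of \<open>Im \<tau> / r\<^sup>2\<close>, with
    \<open>dr\<close> the differential of \<open>r\<close>.\<close>
  have d\<tau>': "Im (d\<tau> / \<mu>\<^sup>2) = Im d\<tau> / r\<^sup>2 - 2 * Im \<tau> * dr / r ^ 3"
  proof -
    have "d\<tau> / \<mu>\<^sup>2 = d\<tau> * (cnj \<mu>)\<^sup>2 / of_real (r ^ 4)"
      unfolding r_def complex_div_cnj[of _ "\<mu>\<^sup>2"] by (simp add: norm_power flip: power_mult)
    then have "Im (d\<tau> / \<mu>\<^sup>2) = Im (d\<tau> * (cnj \<mu>)\<^sup>2) / r ^ 4" by (simp only: Im_divide_of_real)
    also have "Im (d\<tau> * (cnj \<mu>)\<^sup>2) = Im d\<tau> * r\<^sup>2 - 2 * Im \<tau> * (r * dr)"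
      unfolding dr r2 by (simp add: \<mu>_def power2_eq_square algebra_simps)
    also have "(Im d\<tau> * r\<^sup>2 - 2 * Im \<tau> * (r * dr)) / r ^ 4 = Im d\<tau> / r\<^sup>2 - 2 * Im \<tau> * dr / r ^ 3"
      using r by (simp add: power2_eq_square power3_eq_cube power4_eq_xxxx field_simps)
    finally show ?thesis .
  qed
  \<comment> \<open>Conceptually, \<open>\<nu>\<close> is the differential of
    \<open>sqrt (Im \<tau>) *\<^sub>R t\<close> divided by \<open>sqrt (Im \<tau>)\<close>. That
    vector is invariant, and the divisor is itself divided by \<open>r\<close>, so
    \<open>\<nu>\<close> is multiplied by \<open>r\<close>.\<close>
  have \<nu>: "r *\<^sub>R ?dt + dr *\<^sub>R ?t + (Im (d\<tau> / \<mu>\<^sup>2) / (2 * (Im \<tau> / r\<^sup>2))) *\<^sub>R (r *\<^sub>R ?t)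
      = r *\<^sub>R (?dt + (Im d\<tau> / (2 * Im \<tau>)) *\<^sub>R ?t)"
  proof -
    have "dr + Im (d\<tau> / \<mu>\<^sup>2) / (2 * (Im \<tau> / r\<^sup>2)) * r = r * (Im d\<tau> / (2 * Im \<tau>))"
      unfolding d\<tau>' using r \<tau> by (simp add: power2_eq_square power3_eq_cube field_simps)
    then show ?thesis by (simp add: scaleR_add_right flip: scaleR_add_left)
  qed
  define \<kappa> where "\<kappa> = k2 k cu ?db - k2 k ?b dcu"
  have \<kappa>: "k2 k (a *\<^sub>R cu + b *\<^sub>R ?b) (c *\<^sub>R dcu + d *\<^sub>R ?db) - k2 k (c *\<^sub>R cu + d *\<^sub>R ?b) (a *\<^sub>R dcu + b *\<^sub>R ?db) = \<kappa>"
  proof -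
    have "k2 k (a *\<^sub>R cu + b *\<^sub>R ?b) (c *\<^sub>R dcu + d *\<^sub>R ?db) - k2 k (c *\<^sub>R cu + d *\<^sub>R ?b) (a *\<^sub>R dcu + b *\<^sub>R ?db)
        = (a * d - b * c) *\<^sub>R \<kappa>"
      by (simp add: k2_linear \<kappa>_def algebra_simps)
    then show ?thesis unfolding det' by simp
  qed
  \<comment> \<open>With \<open>y\<close> standing for the invariant
    \<open>dcl + \<kappa> /\<^sub>R 6\<close>, this shows that (\<alpha>, \<beta>) transforms like
    (c0, \<psi>).\<close>
  have "d * dc0 - c * d\<psi> + (c *\<^sub>R cu + d *\<^sub>R ?b) \<bullet> y = d * (dc0 + ?b \<bullet> y) - c * (d\<psi> - cu \<bullet> y)"
    "- b * dc0 + a * d\<psi> - (a *\<^sub>R cu + b *\<^sub>R ?b) \<bullet> y = - b * (dc0 + ?b \<bullet> y) + a * (d\<psi> - cu \<bullet> y)" for y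
    by (simp_all add: inner_add_left algebra_simps)
  then show ?thesis
    unfolding p_eq w_eq S_duality_IIB_eq S_duality_IIB_deriv_def IIB_metric_def Let_def prod.case
      mk_vec_simps abcd[symmetric] \<mu>_def[symmetric] r_def[symmetric] dr_def[symmetric] Im' \<kappa> \<kappa>_def[symmetric] \<nu>
    using IIB_form_SL2[OF t \<tau> det', folded \<mu>_def, folded r_def] by (simp only:)
qed

end

section \<open>The action on the q-map space\<close>

lemma W_form_add: "W_form k z i (u + v) = W_form k z i u + W_form k z i v"
  and W_form_diff: "W_form k z i (u - v) = W_form k z i u - W_form k z i v"
  by (cases u; cases v; simp add: W_form_def algebra_simps sum.distrib sum_subtractf)+

lemma sigma_form_add: "sigma_form p (u + v) = sigma_form p u + sigma_form p v"
  and sigma_form_diff: "sigma_form p (u - v) = sigma_form p u - sigma_form p v"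
  by (cases p; cases u; cases v; simp add: sigma_form_inner inner_add_right inner_diff_right)+

lemma sym_prod_polarization:
  assumes "\<alpha> (u + v) = \<alpha> u + \<alpha> v" "\<alpha> (u - v) = \<alpha> u - \<alpha> v"
    "\<beta> (u + v) = \<beta> u + \<beta> v" "\<beta> (u - v) = \<beta> u - \<beta> v"
  shows "sym_prod \<alpha> \<beta> u v = (sym_prod \<alpha> \<beta> (u + v) (u + v) - sym_prod \<alpha> \<beta> (u - v) (u - v)) / 4"
  unfolding sym_prod_def assms by (simp add: field_simps)

lemma tube_metric_polarization:
  "tube_metric k z u v = (tube_metric k z (u + v) (u + v) - tube_metric k z (u - v) (u - v)) / 4"
proof -
  have "sym_prod (\<lambda>w. w $ a) (\<lambda>w. cnj (w $ b)) u v =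
      (sym_prod (\<lambda>w. w $ a) (\<lambda>w. cnj (w $ b)) (u + v) (u + v)
       - sym_prod (\<lambda>w. w $ a) (\<lambda>w. cnj (w $ b)) (u - v) (u - v)) / 4" for a b
    by (rule sym_prod_polarization) simp_all
  then have "tube_metric k z u v = Re (((\<Sum>a\<in>UNIV. \<Sum>b\<in>UNIV.
      wirtinger a (wirtinger_cnj b (\<lambda>w. of_real (kahler_potential k w))) z *
        sym_prod (\<lambda>w. w $ a) (\<lambda>w. cnj (w $ b)) (u + v) (u + v)) -
      (\<Sum>a\<in>UNIV. \<Sum>b\<in>UNIV. wirtinger a (wirtinger_cnj b (\<lambda>w. of_real (kahler_potential k w))) z *
        sym_prod (\<lambda>w. w $ a) (\<lambda>w. cnj (w $ b)) (u - v) (u - v))) / 4)"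
    unfolding tube_metric_def sum_subtractf[symmetric] sum_divide_distrib right_diff_distrib[symmetric]
      times_divide_eq_right[symmetric] by (simp only:)
  then show ?thesis unfolding tube_metric_def by simp
qed

text \<open>Every summand is a symmetric product of additive one-forms, so the diagonal values
  computed above determine the metric.\<close>

lemma qmap_metric_polarization:
  "qmap_metric k p u v = (qmap_metric k p (u + v) (u + v) - qmap_metric k p (u - v) (u - v)) / 4"
proof -
  let ?Ninv = "matrix_inv (N_matrix k (fst p))" and ?Z = "homog (fst p)"
  let ?C = "\<lambda>i j. of_real (?Ninv $ i $ j) - of_real (2 / K_fun k (Im_vec (fst p))) * ?Z $ i * cnj (?Z $ j)"
  let ?s = "\<lambda>i j. sym_prod (W_form k (fst p) i) (\<lambda>w. cnj (W_form k (fst p) j w))"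
  define Q where "Q u v = Re (\<Sum>i\<in>UNIV. \<Sum>j\<in>UNIV. ?C i j * ?s i j u v)" for u v
  have "?s i j u v = (?s i j (u + v) (u + v) - ?s i j (u - v) (u - v)) / 4" for i j
    by (rule sym_prod_polarization) (simp_all add: W_form_add W_form_diff)
  then have sum: "(\<Sum>i\<in>UNIV. \<Sum>j\<in>UNIV. ?C i j * ?s i j u v) =
      ((\<Sum>i\<in>UNIV. \<Sum>j\<in>UNIV. ?C i j * ?s i j (u + v) (u + v))
       - (\<Sum>i\<in>UNIV. \<Sum>j\<in>UNIV. ?C i j * ?s i j (u - v) (u - v))) / 4"
    unfolding sum_subtractf[symmetric] sum_divide_distrib right_diff_distrib[symmetric]
      times_divide_eq_right[symmetric] by (simp only:)
  have "Re ((x - y) / 4) = (Re x - Re y) / 4" for x y by simp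
  then have Q: "Q u v = (Q (u + v) (u + v) - Q (u - v) (u - v)) / 4"
    unfolding Q_def sum .
  have eq: "qmap_metric k p u v = tube_metric k (fst p) (fst u) (fst v)
      + fst (snd u) * fst (snd v) / (4 * (fst (snd p))\<^sup>2) - 1 / (4 * fst (snd p)) * Q u v
      + 1 / (64 * (fst (snd p))\<^sup>2) * sigma_form p u * sigma_form p v" for u v
    unfolding qmap_metric_def Let_def Q_def ..
  have pol: "x * y / A = ((x + y) * (x + y) / A - (x - y) * (x - y) / A) / 4"
    "B * x * y = (B * (x + y) * (x + y) - B * (x - y) * (x - y)) / 4"
    "B * ((q - q') / 4) = (B * q - B * q') / 4" for x y A B q q' :: real
    by (cases "A = 0"; simp add: field_simps)+
  show ?thesis
    unfolding eq[of u v] Q tube_metric_polarization[of k "fst p" "fst u" "fst v"]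
      pol(1)[of "fst (snd u)"] pol(2)[of _ "sigma_form p u"] pol(3)
    unfolding eq[of "u + v"] eq[of "u - v"] sigma_form_add sigma_form_diff fst_add snd_add fst_diff snd_diff
    by (simp add: add_divide_distrib diff_divide_distrib)
qed

section \<open>Smoothness of the building blocks of the coordinate changes\<close>

lemmas smooth_on_Re_vec = smooth_on_bounded_linear[OF bounded_linear_Re_vec]
lemmas smooth_on_Im_vec = smooth_on_bounded_linear[OF bounded_linear_Im_vec]
lemmas smooth_on_k2 = smooth_on_bounded_bilinear[OF bounded_bilinear_k2]

lemma smooth_on_k3:
  fixes f g h :: "'a::euclidean_space \<Rightarrow> real ^ 'n::finite"
  assumes "smooth_on S f" "smooth_on S g" "smooth_on S h"
  shows "smooth_on S (\<lambda>x. k3 k (f x) (g x) (h x))"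
  unfolding inner_k2(1)[symmetric] by (intro smooth_on_inner smooth_on_k2 assms)

lemma smooth_on_cubic:
  fixes f :: "'a::euclidean_space \<Rightarrow> real ^ 'n::finite"
  assumes "smooth_on S f"
  shows "smooth_on S (\<lambda>x. cubic k (f x))"
  unfolding cubic_eq_k3 by (intro smooth_on_divide smooth_on_k3 smooth_on_const assms) simp

lemma smooth_on_cons_vec:
  assumes "smooth_on S f" "smooth_on S g"
  shows "smooth_on S (\<lambda>x. cons_vec (f x) (g x))"
  using smooth_on_bounded_linear[OF bounded_linear_cons_vec smooth_on_Pair[OF assms]] by simp

lemma smooth_on_mk_vec:
  assumes "smooth_on S f" "smooth_on S g"
  shows "smooth_on S (\<lambda>x. mk_vec (f x) (g x))"
  using smooth_on_bounded_linear[OF bounded_linear_mk_vec smooth_on_Pair[OF assms]] by simp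

lemma bounded_linear_tail: "bounded_linear tail"
  unfolding linear_conv_bounded_linear[symmetric] by (auto intro!: linearI simp: vec_eq_iff)

text \<open>Away from zeros of \<open>f\<close>, the modulus is the square root of a positive sum of
  squares.\<close>

lemma smooth_on_cmod:
  assumes "smooth_on S f" "\<And>x. x \<in> S \<Longrightarrow> f x \<noteq> 0"
  shows "smooth_on S (\<lambda>x. cmod (f x))"
proof -
  have "(Re (f x))\<^sup>2 + (Im (f x))\<^sup>2 > 0" if "x \<in> S" for x
    using assms(2)[OF that] by (simp add: complex_neq_0)
  then show ?thesis
    unfolding cmod_def
    by (intro smooth_on_sqrt smooth_on_add smooth_on_power smooth_on_Re smooth_on_Im assms(1))
qed

lemmas smooth_intros = smooth_on_Pair smooth_on_fst smooth_on_snd smooth_on_ident smooth_on_const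
  smooth_on_Re_vec smooth_on_Im_vec smooth_on_k2 smooth_on_k3 smooth_on_cubic smooth_on_cons_vec smooth_on_mk_vec
  smooth_on_bounded_linear[OF bounded_linear_tail] smooth_on_bounded_linear[OF bounded_linear_vec_nth]
  smooth_on_add smooth_on_diff smooth_on_minus smooth_on_mult smooth_on_scaleR smooth_on_inner
  smooth_on_power smooth_on_Re smooth_on_Im smooth_on_Complex

lemma IIA_of_IIB_smooth: "smooth_on S (IIA_of_IIB k)"
proof -
  have eq: "IIA_of_IIB k = (\<lambda>p. (fst p, 1 / 2 * (Im (fst (snd p)))\<^sup>2 * cubic k (Im_vec (fst p)),
         cons_vec (fst (snd (snd (snd (snd p)))) - 1 / 6 * k3 k (Re_vec (fst p)) (Re_vec (fst p))
              (fst (snd (snd p)) - Re (fst (snd p)) *\<^sub>R Re_vec (fst p)))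
           (fst (snd (snd (snd p))) + (1 / 2) *\<^sub>R k2 k (Re_vec (fst p))
              (fst (snd (snd p)) - Re (fst (snd p)) *\<^sub>R Re_vec (fst p))),
         cons_vec (Re (fst (snd p))) (- (fst (snd (snd p)) - Re (fst (snd p)) *\<^sub>R Re_vec (fst p))),
         - 2 * snd (snd (snd (snd (snd p)))) - Re (fst (snd p)) * fst (snd (snd (snd (snd p))))
           + fst (snd (snd (snd p))) \<bullet> (fst (snd (snd p)) - Re (fst (snd p)) *\<^sub>R Re_vec (fst p))
           - 1 / 6 * k3 k (Re_vec (fst p)) (fst (snd (snd p)))
              (fst (snd (snd p)) - Re (fst (snd p)) *\<^sub>R Re_vec (fst p))))"
    by (rule ext) (clarsimp simp: IIA_of_IIB_eq Let_def inverse_eq_divide)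
  show ?thesis unfolding eq by (intro smooth_intros)
qed

text \<open>Smoothness cannot be read off the \<open>inv_into\<close> in \<open>S_duality\<close>,
  so the inverse coordinate change is given by a formula. The root is the positive solution
  \<open>\<tau>\<^sub>2\<close> of \<open>\<rho> = \<tau>\<^sub>2\<^sup>2 h(t) / 2\<close>.\<close>

definition IIB_of_IIA :: "('n::finite \<Rightarrow> 'n \<Rightarrow> 'n \<Rightarrow> real) \<Rightarrow> 'n IIA \<Rightarrow> 'n IIB" where
  "IIB_of_IIA k = (\<lambda>(z, \<rho>, \<zeta>', \<zeta>, \<sigma>).
     let b = Re_vec z; \<tau>1 = \<zeta> $ None; x = - tail \<zeta>; cu = x + \<tau>1 *\<^sub>R b;
         cl = tail \<zeta>' - (1 / 2) *\<^sub>R k2 k b x; c0 = \<zeta>' $ None + 1 / 6 * k3 k b b x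
     in (z, Complex \<tau>1 (sqrt (2 * \<rho> / cubic k (Im_vec z))), cu, cl, c0,
         1 / 2 * (cl \<bullet> x - 1 / 6 * k3 k b cu x - \<sigma> - \<tau>1 * c0)))"

lemma cons_vec_eq: "cons_vec (v $ None) (tail v) = v"
  by (simp add: cons_vec_def vec_eq_iff split: option.split)

lemma S_duality_IIB_one: "S_duality_IIB (mat 1) p = p"
  by (cases p) (simp add: S_duality_IIB_eq mat_def mk_vec_def vec_eq_iff)

section \<open>S-duality and the coordinate changes as smooth maps\<close>

context psr
begin

text \<open>Inherited from the cone. Openness lets ambient derivatives be transferred between
  functions that agree on the q-map space.\<close>

lemma open_qmap_space: "open (qmap_space H)"
proof -
  have "continuous_on UNIV Im_vec"
    by (rule bounded_linear.continuous_on[OF bounded_linear_Im_vec continuous_on_id])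
  then have "open (tube_domain H)"
    using open_vimage[OF open_cone, of Im_vec] by (simp add: tube_domain_def vimage_def)
  then show ?thesis unfolding qmap_space_def by (intro open_Times) auto
qed

lemma IIB_of_IIA:
  assumes "q \<in> qmap_space H"
  shows "IIB_of_IIA k q \<in> IIB_domain H" "IIA_of_IIB k (IIB_of_IIA k q) = q"
proof -
  obtain z \<rho> \<zeta>' \<zeta> \<sigma> where q: "q = (z, \<rho>, \<zeta>', \<zeta>, \<sigma>)" by (cases q)
  have "h (Im_vec z) > 0" "\<rho> > 0" "z \<in> tube_domain H"
    using assms h_pos unfolding q qmap_space_def tube_domain_def by auto
  then show "IIB_of_IIA k q \<in> IIB_domain H" "IIA_of_IIB k (IIB_of_IIA k q) = q"
    unfolding q IIB_of_IIA_def IIB_domain_def Let_def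
    by (simp_all add: IIA_of_IIB_eq Let_def cons_vec_eq inverse_eq_divide diff_divide_distrib add_divide_distrib)
qed

lemma inv_IIA_of_IIB:
  assumes "q \<in> qmap_space H"
  shows "inv_into (IIB_domain H) (IIA_of_IIB k) q = IIB_of_IIA k q"
  using IIB_of_IIA[OF assms] IIA_of_IIB_bij_betw[OF psr] by (auto simp: bij_betw_def intro: inv_into_f_eq)

lemma IIB_of_IIA_smooth: "smooth_on (qmap_space H) (IIB_of_IIA k)"
proof -
  have pos: "h (Im_vec (fst q)) > 0" "fst (snd q) > 0" if "q \<in> qmap_space H" for q :: "'n IIA"
    using that h_pos unfolding qmap_space_def tube_domain_def by auto
  then have *: "smooth_on (qmap_space H) (\<lambda>q :: 'n IIA. sqrt (2 * fst (snd q) / h (Im_vec (fst q))))"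
    by (intro smooth_on_sqrt smooth_on_divide smooth_intros) (auto dest: pos)
  show ?thesis
    unfolding IIB_of_IIA_def case_prod_beta Let_def
    by (intro smooth_intros *)
qed

lemma S_duality_IIB_smooth:
  assumes det: "det A = 1"
  shows "smooth_on (IIB_domain H) (S_duality_IIB A)"
proof -
  define a b c d where abcd: "a = A $ 1 $ 1" "b = A $ 1 $ 2" "c = A $ 2 $ 1" "d = A $ 2 $ 2"
  have det': "a * d - b * c = 1" using det unfolding det_SL2 abcd .
  have eq: "S_duality_IIB A = (\<lambda>p.
     (mk_vec (c *\<^sub>R fst (snd (snd p)) + d *\<^sub>R Re_vec (fst p))
        (norm (of_real c * fst (snd p) + of_real d) *\<^sub>R Im_vec (fst p)),
     (of_real a * fst (snd p) + of_real b) / (of_real c * fst (snd p) + of_real d),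
     a *\<^sub>R fst (snd (snd p)) + b *\<^sub>R Re_vec (fst p), fst (snd (snd (snd p))),
     d * fst (snd (snd (snd (snd p)))) - c * snd (snd (snd (snd (snd p)))),
     - b * fst (snd (snd (snd (snd p)))) + a * snd (snd (snd (snd (snd p))))))"
    by (rule ext) (clarsimp simp: S_duality_IIB_eq abcd)
  have \<mu>: "of_real c * fst (snd p) + of_real d \<noteq> 0" if "p \<in> IIB_domain H" for p :: "'n IIB"
  proof (rule moebius_denominator_nonzero)
    show "Im (fst (snd p)) > 0" using that by (auto simp: IIB_domain_def)
    show "c \<noteq> 0 \<or> d \<noteq> 0" using det' by auto
  qed
  show ?thesis
    unfolding eq by (intro smooth_intros smooth_on_cmod smooth_on_divide \<mu>)
qed

text \<open>The factor c\<tau> + d is a cocycle: for a product of matrices it is the product of the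
  factors at the two successive points. This handles \<tau> and \<open>t\<close>. The pair (c0,
  \<psi>) transforms by the cofactor matrix, which is multiplicative too.\<close>

lemma S_duality_IIB_mult:
  assumes p: "p \<in> IIB_domain H" and det: "det B = 1"
  shows "S_duality_IIB (A ** B) p = S_duality_IIB A (S_duality_IIB B p)"
proof -
  obtain z \<tau> cu cl c0 \<psi> where p_eq: "p = (z, \<tau>, cu, cl, c0, \<psi>)" by (cases p)
  have \<tau>: "Im \<tau> > 0" using p unfolding p_eq IIB_domain_def by auto
  define a b c d where abcd: "a = A $ 1 $ 1" "b = A $ 1 $ 2" "c = A $ 2 $ 1" "d = A $ 2 $ 2"
  define a' b' c' d' where abcd': "a' = B $ 1 $ 1" "b' = B $ 1 $ 2" "c' = B $ 2 $ 1" "d' = B $ 2 $ 2"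
  have AB: "(A ** B) $ 1 $ 1 = a * a' + b * c'" "(A ** B) $ 1 $ 2 = a * b' + b * d'"
    "(A ** B) $ 2 $ 1 = c * a' + d * c'" "(A ** B) $ 2 $ 2 = c * b' + d * d'"
    by (simp_all add: matrix_matrix_mult_def sum_2 abcd abcd')
  have "c' \<noteq> 0 \<or> d' \<noteq> 0" using det unfolding det_SL2 abcd'[symmetric] by auto
  then have \<mu>: "of_real c' * \<tau> + of_real d' \<noteq> 0"
    using moebius_denominator_nonzero \<tau> by blast
  let ?\<mu> = "of_real c' * \<tau> + of_real d'" and ?\<tau>' = "(of_real a' * \<tau> + of_real b') / (of_real c' * \<tau> + of_real d')"
  have frac: "of_real x * ?\<tau>' + of_real y = (of_real (x * a' + y * c') * \<tau> + of_real (x * b' + y * d')) / ?\<mu>" for x y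
    using \<mu> by (simp add: field_simps)
  have e1: "cmod (of_real (c * a' + d * c') * \<tau> + of_real (c * b' + d * d')) = cmod (of_real c * ?\<tau>' + of_real d) * cmod ?\<mu>"
    unfolding frac using \<mu> by (simp add: norm_divide)
  have e2: "(of_real (a * a' + b * c') * \<tau> + of_real (a * b' + b * d')) / (of_real (c * a' + d * c') * \<tau> + of_real (c * b' + d * d'))
      = (of_real a * ?\<tau>' + of_real b) / (of_real c * ?\<tau>' + of_real d)"
    unfolding frac using \<mu> by simp
  have e3: "(x * a' + y * c') *\<^sub>R v + (x * b' + y * d') *\<^sub>R w
      = x *\<^sub>R (a' *\<^sub>R v + b' *\<^sub>R w) + y *\<^sub>R (c' *\<^sub>R v + d' *\<^sub>R w)" for x y and v w :: "real ^ 'n"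
    by (simp add: algebra_simps)
  have e4: "(c * b' + d * d') * c0 - (c * a' + d * c') * \<psi> = d * (d' * c0 - c' * \<psi>) - c * (- b' * c0 + a' * \<psi>)"
    "- (a * b' + b * d') * c0 + (a * a' + b * c') * \<psi> = - b * (d' * c0 - c' * \<psi>) + a * (- b' * c0 + a' * \<psi>)"
    by (simp_all add: algebra_simps)
  show ?thesis
    unfolding p_eq S_duality_IIB_eq AB abcd[symmetric] abcd'[symmetric] mk_vec_simps e1 e2 e3 e4 scaleR_scaleR ..
qed

section \<open>The group action on the q-map space\<close>

lemma S_duality_eq:
  "q \<in> qmap_space H \<Longrightarrow> S_duality k H A q = IIA_of_IIB k (S_duality_IIB A (IIB_of_IIA k q))"
  by (simp add: S_duality_def inv_IIA_of_IIB)

lemma S_duality_in_qmap_space: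
  assumes "q \<in> qmap_space H" "det A = 1"
  shows "S_duality k H A q \<in> qmap_space H"
  using S_duality_IIB_in_domain[OF IIB_of_IIA(1)[OF assms(1)] assms(2)] IIA_of_IIB_bij_betw[OF psr]
  unfolding S_duality_eq[OF assms(1)] bij_betw_def by blast

lemma S_duality_mult:
  assumes q: "q \<in> qmap_space H" and "det B = 1"
  shows "S_duality k H (A ** B) q = S_duality k H A (S_duality k H B q)"
proof -
  let ?p = "S_duality_IIB B (IIB_of_IIA k q)"
  have p: "?p \<in> IIB_domain H" using S_duality_IIB_in_domain[OF IIB_of_IIA(1)[OF q] assms(2)] .
  have "inj_on (IIA_of_IIB k) (IIB_domain H)" using IIA_of_IIB_bij_betw[OF psr] by (simp add: bij_betw_def)
  then have "IIB_of_IIA k (IIA_of_IIB k ?p) = ?p"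
    using inv_IIA_of_IIB[OF S_duality_in_qmap_space[OF assms]] inv_into_f_f p
    unfolding S_duality_eq[OF q] by fastforce
  then show ?thesis
    unfolding S_duality_eq[OF S_duality_in_qmap_space[OF assms]]
    unfolding S_duality_eq[OF q] S_duality_IIB_mult[OF IIB_of_IIA(1)[OF q] assms(2)] by simp
qed

lemma S_duality_one: "q \<in> qmap_space H \<Longrightarrow> S_duality k H (mat 1) q = q"
  by (simp add: S_duality_eq S_duality_IIB_one IIB_of_IIA)

lemma SL2_inverse:
  assumes "det A = 1"
  obtains B :: "real ^ 2 ^ 2" where "det B = 1" "A ** B = mat 1" "B ** A = mat 1"
proof -
  have "invertible A" using assms by (simp add: invertible_det_nz)
  then obtain B where B: "A ** B = mat 1" "B ** A = mat 1" unfolding invertible_def by blast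
  then have "det A * det B = 1" by (metis det_I det_mul)
  then show ?thesis using B assms that by simp
qed

lemma group_SL2R: "group SL2R"
proof (rule groupI)
  fix A assume "A \<in> carrier SL2R"
  then have "det A = 1" by (simp add: SL2R_def)
  then obtain B where "det B = 1" "B ** A = mat 1" using SL2_inverse by metis
  then show "\<exists>B\<in>carrier SL2R. B \<otimes>\<^bsub>SL2R\<^esub> A = \<one>\<^bsub>SL2R\<^esub>" by (auto simp: SL2R_def)
qed (auto simp: SL2R_def det_mul matrix_mul_assoc)

text \<open>The inverse matrix provides the inverse map. The second claim gives this for
  \<open>inv_into\<close>, from which smoothness of the inverse follows.\<close>

lemma S_duality_bij:
  assumes "det A = 1"
  shows "bij_betw (S_duality k H A) (qmap_space H) (qmap_space H)"
    and "det B = 1 \<Longrightarrow> A ** B = mat 1 \<Longrightarrow> q \<in> qmap_space H \<Longrightarrow>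
      inv_into (qmap_space H) (S_duality k H A) q = S_duality k H B q"
proof -
  obtain C where C: "det C = 1" "A ** C = mat 1" "C ** A = mat 1" using SL2_inverse[OF assms] .
  have "S_duality k H C (S_duality k H A q) = q" "S_duality k H A (S_duality k H C q) = q"
    if "q \<in> qmap_space H" for q
    using that assms C S_duality_one S_duality_mult by metis+
  then show bij: "bij_betw (S_duality k H A) (qmap_space H) (qmap_space H)"
    using assms C(1) S_duality_in_qmap_space
    by (intro bij_betw_byWitness[where f' = "S_duality k H C"]) auto
  show "inv_into (qmap_space H) (S_duality k H A) q = S_duality k H B q"
    if "det B = 1" "A ** B = mat 1" "q \<in> qmap_space H"
  proof (rule inv_into_f_eq)
    show "inj_on (S_duality k H A) (qmap_space H)" using bij by (simp add: bij_betw_def)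
    show "S_duality k H B q \<in> qmap_space H" by (rule S_duality_in_qmap_space[OF that(3,1)])
    show "S_duality k H A (S_duality k H B q) = q"
      using S_duality_mult[OF that(3,1), of A] S_duality_one[OF that(3)] that(2) by simp
  qed
qed

text \<open>The elements of \<open>BijGroup\<close> are extensional bijections multiplied by
  \<open>compose\<close>, so the homomorphism property is an equality of functions that also covers
  the points outside the q-map space.\<close>

lemma group_action_S_duality: "group_action SL2R (qmap_space H) (S_duality k H)"
proof -
  let ?N = "qmap_space H"
  have Bij: "S_duality k H A \<in> Bij ?N" if "det A = 1" for A
    using S_duality_bij(1)[OF that] by (auto simp: Bij_def S_duality_def)
  have "S_duality k H (A ** B) = compose ?N (S_duality k H A) (S_duality k H B)" if "det B = 1" for A B
    using S_duality_mult[OF _ that] by (auto simp: compose_def S_duality_def restrict_def fun_eq_iff)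
  then have "S_duality k H \<in> hom SL2R (BijGroup ?N)"
    using Bij by (auto simp: hom_def SL2R_def BijGroup_def)
  then show ?thesis
    unfolding group_action_def group_hom_def group_hom_axioms_def
    using group_SL2R group_BijGroup by blast
qed

section \<open>Isometries of the q-map metric\<close>

lemma S_duality_smooth:
  assumes "det A = 1"
  shows "smooth_on (qmap_space H) (S_duality k H A)"
proof (rule smooth_on_cong[OF open_qmap_space])
  show "smooth_on (qmap_space H) (\<lambda>q. IIA_of_IIB k (S_duality_IIB A (IIB_of_IIA k q)))"
    by (rule smooth_on_compose[OF IIA_of_IIB_smooth[of UNIV] smooth_on_compose[OF
          S_duality_IIB_smooth[OF assms] IIB_of_IIA_smooth]]) (auto intro: IIB_of_IIA)
qed (simp add: S_duality_eq)

text \<open>A tangent vector \<open>u\<close> at \<open>q\<close> is represented by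
  \<open>E u\<close> in type IIB coordinates, where \<open>IIB_metric\<close> is invariant. This
  settles the diagonal values, and linearity of \<open>D\<close> with polarization gives the
  bilinear form.\<close>

lemma S_duality_preserves_metric:
  assumes q: "q \<in> qmap_space H" and det: "det A = 1"
  defines "D \<equiv> frechet_derivative (S_duality k H A) (at q)"
  shows "qmap_metric k (S_duality k H A q) (D u) (D v) = qmap_metric k q u v"
proof -
  define p where "p = IIB_of_IIA k q"
  have p: "p \<in> IIB_domain H" "IIA_of_IIB k p = q" unfolding p_def by (rule IIB_of_IIA[OF q])+
  define E where "E = frechet_derivative (IIB_of_IIA k) (at q)"
  have E: "(IIB_of_IIA k has_derivative E) (at q)"
    unfolding E_def by (rule smooth_on_imp_differentiable[OF IIB_of_IIA_smooth q])
  have D: "(S_duality k H A has_derivative D) (at q)"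
    unfolding D_def by (rule smooth_on_imp_differentiable[OF S_duality_smooth[OF det] q])
  have "((\<lambda>q. IIA_of_IIB k (IIB_of_IIA k q)) has_derivative (\<lambda>u. IIA_of_IIB_deriv k p (E u))) (at q)"
    unfolding p_def by (rule has_derivative_compose[OF E IIA_of_IIB_has_derivative])
  then have "((\<lambda>q. q) has_derivative (\<lambda>u. IIA_of_IIB_deriv k p (E u))) (at q)"
    by (rule has_derivative_transform_within_open[OF _ open_qmap_space q]) (simp add: IIB_of_IIA)
  \<comment> \<open>The coordinate changes compose to the identity near \<open>q\<close>, hence so
    do their differentials.\<close>
  then have id: "IIA_of_IIB_deriv k p (E u) = u" for u
    using has_derivative_unique[OF has_derivative_ident] by (metis (no_types))
  have "((\<lambda>q. IIA_of_IIB k (S_duality_IIB A (IIB_of_IIA k q))) has_derivative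
      (\<lambda>u. IIA_of_IIB_deriv k (S_duality_IIB A p) (S_duality_IIB_deriv A p (E u)))) (at q)"
    unfolding p_def
    by (rule has_derivative_compose[OF has_derivative_compose[OF E
          S_duality_IIB_has_derivative[OF p(1)[unfolded p_def] det]] IIA_of_IIB_has_derivative])
  then have "(S_duality k H A has_derivative
      (\<lambda>u. IIA_of_IIB_deriv k (S_duality_IIB A p) (S_duality_IIB_deriv A p (E u)))) (at q)"
    by (rule has_derivative_transform_within_open[OF _ open_qmap_space q]) (simp add: S_duality_eq)
  then have D_eq: "D u = IIA_of_IIB_deriv k (S_duality_IIB A p) (S_duality_IIB_deriv A p (E u))" for u
    using has_derivative_unique[OF D] by metis
  have quad: "qmap_metric k (S_duality k H A q) (D u) (D u) = qmap_metric k q u u" for u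
  proof -
    have "qmap_metric k (S_duality k H A q) (D u) (D u) = IIB_metric p (E u)"
      unfolding S_duality_eq[OF q] p_def[symmetric] D_eq
        qmap_metric_IIB[OF S_duality_IIB_in_domain[OF p(1) det]] IIB_metric_S_duality_IIB[OF p(1) det] ..
    also have "\<dots> = qmap_metric k q u u"
      unfolding qmap_metric_IIB[OF p(1), symmetric] id p(2) ..
    finally show ?thesis .
  qed
  interpret D: bounded_linear D using D by (rule has_derivative_bounded_linear)
  show ?thesis
    unfolding qmap_metric_polarization[of k "S_duality k H A q" "D u"] qmap_metric_polarization[of k q u]
      D.add[symmetric] D.diff[symmetric] quad ..
qed

lemma isometry_S_duality:
  assumes det: "det A = 1"
  shows "isometry_on (qmap_space H) (qmap_metric k) (S_duality k H A)"
proof -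
  obtain B where B: "det B = 1" "A ** B = mat 1" using SL2_inverse[OF det] by metis
  have "smooth_on (qmap_space H) (inv_into (qmap_space H) (S_duality k H A))"
    by (rule smooth_on_cong[OF open_qmap_space _ S_duality_smooth[OF B(1)]])
      (simp add: S_duality_bij(2)[OF det B])
  then show ?thesis
    unfolding isometry_on_def
    using S_duality_bij(1)[OF det] S_duality_smooth[OF det] S_duality_preserves_metric[OF _ det] by blast
qed

end

theorem theorem3p16:
  fixes k :: "'n::finite \<Rightarrow> 'n \<Rightarrow> 'n \<Rightarrow> real" and H :: "(real ^ 'n) set"
  assumes "symmetric3 k" and "psr_manifold k H"
  shows "group_action SL2R (qmap_space H) (S_duality k H) \<and>
    (\<forall>A \<in> carrier SL2R. isometry_on (qmap_space H) (qmap_metric k) (S_duality k H A))"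
proof -
  interpret psr k H
    by unfold_locales (fact assms)+
  show ?thesis
    using group_action_S_duality isometry_S_duality by (simp add: SL2R_def)
qed

end
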